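(* Let $n>d\ge 1$ be integers, let $\bm{A}\in\mathbb{R}^{d\times(n-d)}$, $\bm{\alpha}_0\in\mathbb{R}^{1\times(n-d)}$, $\widetilde{\bm{A}}=\binom{\bm{\alpha}_0}{\bm{A}}\in\mathbb{R}^{(d+1)\times(n-d)}$, and $\mathscr{H}=\{(\bm{x},\widetilde{\bm{x}}\cdot\widetilde{\bm{A}}):\bm{x}\in\mathbb{R}^d\}$ with $\widetilde{\bm{x}}=(1,\bm{x})$. Let $s>0$ and let $\psi:\mathbb{N}\to\mathbb{R}_{\ge0}$ be non-increasing. If $\sum_{q=1}^\infty\psi(q)^{n-d+s}q^{d-s}<\infty$ and $\omega(\widetilde{\bm{A}})<\frac{(d+1)(n-d+s)}{d+1-s}$, then $\mathcal{H}^s(\mathscr{S}_n(\psi)\cap\mathscr{H})=0$.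
   Context: $\mathcal{H}^s$ is $s$-dimensional Hausdorff measure. For $y\in\mathbb{R}$, $\|y\|$ is the distance to the nearest integer; for vectors $\|\bm{y}\|=\max_k\|y_k\|$ and $|\bm{y}|$ is the supremum norm. $\mathscr{S}_n(\psi)=\{\bm{x}\in\mathbb{R}^n:\|q\bm{x}\|<\psi(q)\text{ for infinitely many }q\in\mathbb{N}\}$. For $\bm{M}\in\mathbb{R}^{l\times m}$ with rows $\mathrm{row}_u(\bm{M})$, $\omega(\bm{M})$ is the supremum of all $\omega$ for which $\prod_{u=1}^l\|\bm{j}\cdot\mathrm{row}_u(\bm{M})\|<|\bm{j}|^{-\omega}$ has infinitely many solutions $\bm{j}\in\mathbb{Z}^m$. *)

theory Defs
  imports "HOL-Analysis.Analysis"
begin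

text \<open>
  Hausdorff measure for \<open>s > 0\<close>, without normalising constant.  Boundedness of the covering sets
  is required explicitly because \<^const>\<open>diameter\<close> is unspecified on unbounded sets.  Since
  \<open>0 powr s = 0\<close>, empty sets contribute nothing, so finite covers are included.  The supremum over
  \<open>\<delta> > 0\<close> is the limit as \<open>\<delta>\<close> tends to 0.
\<close>

definition hausdorff_premeasure :: "real \<Rightarrow> real \<Rightarrow> 'a::metric_space set \<Rightarrow> ennreal" where
  "hausdorff_premeasure s \<delta> E =
     (INF U \<in> {U :: nat \<Rightarrow> 'a set. (\<forall>i. bounded (U i) \<and> diameter (U i) \<le> \<delta>) \<and> E \<subseteq> (\<Union>i. U i)}.
        \<Sum>i. ennreal (diameter (U i) powr s))"

definition hausdorff_measure :: "real \<Rightarrow> 'a::metric_space set \<Rightarrow> ennreal" where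
  "hausdorff_measure s E = (SUP \<delta> \<in> {0<..}. hausdorff_premeasure s \<delta> E)"

definition dist_int :: "real \<Rightarrow> real" where
  "dist_int y = infdist y \<int>"

definition dist_int_vec :: "real ^ 'n \<Rightarrow> real" where
  "dist_int_vec y = Max (range (\<lambda>k. dist_int (y $ k)))"

definition simult_approx :: "(nat \<Rightarrow> real) \<Rightarrow> (real ^ 'n) set" where
  "simult_approx \<psi> = {x. infinite {q::nat. 1 \<le> q \<and> dist_int_vec (real q *\<^sub>R x) < \<psi> q}}"

text \<open>
  The multiplicative Diophantine exponent.  Its value may be \<open>\<infinity>\<close>.
\<close>

definition mult_exponent :: "real ^ 'm ^ 'l \<Rightarrow> ereal" where
  "mult_exponent M = Sup (ereal ` {w::real.
     infinite {j :: real ^ 'm. (\<forall>k. j $ k \<in> \<int>) \<and>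
       (\<Prod>u\<in>UNIV. dist_int (j \<bullet> row u M)) < infnorm j powr (- w)}})"

text \<open>
  A space of dimension \<open>d + 1\<close> is indexed by \<^typ>\<open>'d option\<close>, with \<^const>\<open>None\<close> as the index of
  the leading coordinate; \<open>\<real>\<^sup>n\<close> with \<open>n = d + (n - d)\<close> is indexed by \<^typ>\<open>'d + 'm\<close>.
\<close>

definition prepend_one :: "real ^ ('d::finite) \<Rightarrow> real ^ ('d option)" where
  "prepend_one x = (\<chi> u. case u of None \<Rightarrow> 1 | Some i \<Rightarrow> x $ i)"

definition prepend_row :: "real ^ ('m::finite) \<Rightarrow> real ^ 'm ^ ('d::finite) \<Rightarrow> real ^ 'm ^ ('d option)" where
  "prepend_row \<alpha>\<^sub>0 A = (\<chi> u. case u of None \<Rightarrow> \<alpha>\<^sub>0 | Some i \<Rightarrow> A $ i)"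

definition vec_append :: "real ^ ('d::finite) \<Rightarrow> real ^ ('m::finite) \<Rightarrow> real ^ ('d + 'm)" where
  "vec_append x y = (\<chi> k. case k of Inl i \<Rightarrow> x $ i | Inr j \<Rightarrow> y $ j)"

definition affine_graph :: "real ^ ('m::finite) ^ ('d::finite option) \<Rightarrow> (real ^ ('d + 'm)) set" where
  "affine_graph M = range (\<lambda>x :: real ^ 'd. vec_append x (prepend_one x v* M))"

end

theory Submission
  imports Defs
begin

text \<open>
  If \<open>x\<close> lies in a bounded part of \<open>\<real>\<^sup>d\<close> and \<open>\<parallel>q (x, f x)\<parallel> < \<psi>(q)\<close> with \<open>q \<approx> Q = 2\<^sup>k\<close>, then \<open>x\<close> is
  within \<open>\<psi>(Q)/Q\<close> of \<open>p/q\<close> for an integer vector \<open>v = (q, p)\<close> of size \<open>O(Q)\<close> with \<open>\<parallel>v M\<parallel> \<le> \<delta> = O(\<psi>(Q))\<close>.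
  A Fejer-kernel argument with frequencies \<open>j \<in> \<int>\<^sup>m\<close>, \<open>|j| \<le> J = O(1/\<delta>)\<close>, bounds the number of such \<open>v\<close> by
  a multiple of \<open>\<delta>\<^sup>m\<close> times the sum over \<open>j\<close> of \<open>\<Prod>\<^sub>u min (Q, 1/\<parallel>j \<cdot> row\<^sub>u M\<parallel>)\<close>.  For \<open>w\<close> above the multiplicative
  exponent, \<open>\<Prod>\<^sub>u \<parallel>j \<cdot> row\<^sub>u M\<parallel> \<ge> c |j| powr -w\<close>; applied to differences of frequencies this bounds the terms
  with \<open>j \<noteq> 0\<close> by \<open>J powr w\<close> up to logarithms, which is \<open>O(Q\<^sup>d\<^sup>+\<^sup>1)\<close> as long as \<open>\<delta> \<ge> Q powr -\<tau>\<close> with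
  \<open>\<tau> w < d + 1\<close>.  Hence there are \<open>O(\<delta>\<^sup>m Q\<^sup>d\<^sup>+\<^sup>1)\<close> balls of radius \<open>O(\<delta>/Q)\<close>, where
  \<open>\<psi>(Q)\<close> is first enlarged to \<open>max (\<psi>(Q)) (Q powr -\<tau>)\<close>; the bound on the exponent allows a \<open>\<tau>\<close> for which the
  additional term stays summable over the dyadic levels, and the Borel-Cantelli argument applies.
  For \<open>s > d\<close> the whole graph is already null.
\<close>

section \<open>Hausdorff content\<close>

text \<open>The covering sets may have any diameter, so \<open>a\<close> bounds the Hausdorff
  content. Zero content forces zero measure when \<open>s > 0\<close>
  (\<open>hausdorff_measure_null\<close>), and content is easier to add up.\<close>

definition hausdorff_cover :: "real \<Rightarrow> ennreal \<Rightarrow> 'a::metric_space set \<Rightarrow> bool" where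
  "hausdorff_cover s a E \<longleftrightarrow>
     (\<exists>U :: nat \<Rightarrow> 'a set. (\<forall>i. bounded (U i)) \<and> E \<subseteq> (\<Union>i. U i) \<and>
        (\<Sum>i. ennreal (diameter (U i) powr s)) \<le> a)"

definition hausdorff_null :: "real \<Rightarrow> 'a::metric_space set \<Rightarrow> bool" where
  "hausdorff_null s E \<longleftrightarrow> (\<forall>\<epsilon>>0. hausdorff_cover s (ennreal \<epsilon>) E)"

lemma hausdorff_cover_mono:
  assumes "hausdorff_cover s a E" "a \<le> b" "F \<subseteq> E"
  shows "hausdorff_cover s b F"
  using assms unfolding hausdorff_cover_def by (meson order_trans)

lemma hausdorff_cover_finite:
  assumes "finite I" and "\<And>i. i \<in> I \<Longrightarrow> bounded (B i)" and "\<And>i. i \<in> I \<Longrightarrow> diameter (B i) \<le> r"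
    and "r \<ge> 0" "s > 0"
  shows "hausdorff_cover s (ennreal (real (card I) * r powr s)) (\<Union>i\<in>I. B i)"
proof -
  obtain h where h: "bij_betw h {0..<card I} I"
    using assms(1) ex_bij_betw_nat_finite by blast
  \<comment> \<open>Empty sets pad the finite family to a sequence at no cost: their diameter is 0
    and \<open>0 powr s = 0\<close>.\<close>
  define U where "U = (\<lambda>n. if n < card I then B (h n) else {})"
  have hI: "h n \<in> I" if "n < card I" for n
    using h that by (auto simp: bij_betw_def)
  have bd: "bounded (U i)" for i
    using assms(2) hI by (auto simp: U_def)
  have "(\<Union>i\<in>I. B i) \<subseteq> (\<Union>n. U n)"
  proof
    fix x assume "x \<in> (\<Union>i\<in>I. B i)"
    then obtain i where "i \<in> I" "x \<in> B i" by blast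
    moreover then obtain n where "n < card I" "h n = i"
      using bij_betw_imp_surj_on[OF h] by (metis atLeastLessThan_iff imageE)
    ultimately show "x \<in> (\<Union>n. U n)" by (auto simp: U_def)
  qed
  moreover have "(\<Sum>i. ennreal (diameter (U i) powr s)) = (\<Sum>i<card I. ennreal (diameter (U i) powr s))"
    by (rule suminf_finite) (auto simp: U_def)
  moreover have "\<dots> \<le> (\<Sum>i<card I. ennreal (r powr s))"
  proof (rule sum_mono)
    fix i assume "i \<in> {..<card I}"
    then have i: "i < card I" by simp
    have "0 \<le> diameter (U i)" by (rule diameter_ge_0[OF bd])
    moreover have "diameter (U i) \<le> r"
      using assms(3)[OF hI[OF i]] i by (auto simp: U_def)
    ultimately show "ennreal (diameter (U i) powr s) \<le> ennreal (r powr s)"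
      using assms(5) by (intro ennreal_leI powr_mono2) auto
  qed
  moreover have "(\<Sum>i<card I. ennreal (r powr s)) = ennreal (real (card I) * r powr s)"
    by (simp add: ennreal_mult ennreal_of_nat_eq_real_of_nat)
  ultimately show ?thesis
    unfolding hausdorff_cover_def using bd by (intro exI[of _ U]) auto
qed

lemma hausdorff_cover_UN:
  fixes E :: "nat \<Rightarrow> 'a::metric_space set"
  assumes "\<And>k. hausdorff_cover s (a k) (E k)"
  shows "hausdorff_cover s (\<Sum>k. a k) (\<Union>k. E k)"
proof -
  obtain U where U: "\<And>k i. bounded (U k i)" "\<And>k. E k \<subseteq> (\<Union>i. U k i)"
    "\<And>k. (\<Sum>i. ennreal (diameter (U k i) powr s)) \<le> a k"
    using assms unfolding hausdorff_cover_def by metis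
  define f where "f = (\<lambda>(k, i). ennreal (diameter (U k i) powr s))"
  define V where "V = (\<lambda>n. case prod_decode n of (k, i) \<Rightarrow> U k i)"
  have "(\<Sum>n. ennreal (diameter (V n) powr s)) = (\<Sum>n. f (prod_decode n))"
    by (simp add: f_def V_def case_prod_unfold)
  also have "\<dots> = (\<Sum>k. \<Sum>i. f (k, i))"
    by (rule suminf_ennreal_2dimen) simp
  also have "\<dots> \<le> (\<Sum>k. a k)"
    using U(3) by (intro suminf_le) (auto simp: f_def)
  finally have 1: "(\<Sum>n. ennreal (diameter (V n) powr s)) \<le> (\<Sum>k. a k)" .
  have 2: "(\<Union>k. E k) \<subseteq> (\<Union>n. V n)"
  proof
    fix x assume "x \<in> (\<Union>k. E k)"
    then obtain k i where "x \<in> U k i" using U(2) by blast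
    then have "x \<in> V (prod_encode (k, i))" by (simp add: V_def)
    then show "x \<in> (\<Union>n. V n)" by blast
  qed
  have "\<And>n. bounded (V n)"
    using U(1) by (auto simp: V_def split: prod.split)
  then show ?thesis
    unfolding hausdorff_cover_def using 1 2 by blast
qed

lemma hausdorff_null_subset: "hausdorff_null s E \<Longrightarrow> F \<subseteq> E \<Longrightarrow> hausdorff_null s F"
  unfolding hausdorff_null_def using hausdorff_cover_mono by blast

lemma hausdorff_null_UN:
  fixes E :: "nat \<Rightarrow> 'a::metric_space set"
  assumes "\<And>k. hausdorff_null s (E k)"
  shows "hausdorff_null s (\<Union>k. E k)"
  unfolding hausdorff_null_def
proof (intro allI impI)
  fix \<epsilon> :: real assume "\<epsilon> > 0"
  have "hausdorff_cover s (\<Sum>k. ennreal (\<epsilon> * (1/2) ^ Suc k)) (\<Union>k. E k)"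
    using assms \<open>\<epsilon> > 0\<close> by (intro hausdorff_cover_UN) (auto simp: hausdorff_null_def)
  moreover have "(\<lambda>k. \<epsilon> * (1/2) ^ Suc k) sums (\<epsilon> * 1)"
    using power_half_series by (rule sums_mult)
  then have "(\<Sum>k. ennreal (\<epsilon> * (1/2) ^ Suc k)) = ennreal \<epsilon>"
    using \<open>\<epsilon> > 0\<close> by (intro suminf_ennreal_eq) auto
  ultimately show "hausdorff_cover s (ennreal \<epsilon>) (\<Union>k. E k)" by simp
qed

text \<open>The convergence half of the Borel-Cantelli lemma: \<open>E\<close> lies in every tail
  union, and the tails of a convergent series of costs become arbitrarily small.\<close>

lemma hausdorff_null_limsup:
  fixes E :: "'a::metric_space set" and G :: "nat \<Rightarrow> 'a set"
  assumes "\<And>k. hausdorff_cover s (ennreal (a k)) (G k)" and "\<And>k. a k \<ge> 0" and "summable a"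
    and "\<And>N. E \<subseteq> (\<Union>k. G (k + N))"
  shows "hausdorff_null s E"
  unfolding hausdorff_null_def
proof (intro allI impI)
  fix \<epsilon> :: real assume "\<epsilon> > 0"
  obtain N where "norm (\<Sum>i. a (i + N)) < \<epsilon>"
    using suminf_exist_split[OF \<open>\<epsilon> > 0\<close> assms(3)] by blast
  then have N: "(\<Sum>i. a (i + N)) \<le> \<epsilon>" by simp
  have "hausdorff_cover s (\<Sum>k. ennreal (a (k + N))) (\<Union>k. G (k + N))"
    using assms(1) by (rule hausdorff_cover_UN)
  moreover have "(\<Sum>k. ennreal (a (k + N))) = ennreal (\<Sum>k. a (k + N))"
    using assms(2,3) by (intro suminf_ennreal2) (auto simp: summable_iff_shift)
  ultimately show "hausdorff_cover s (ennreal \<epsilon>) E"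
    using assms(4) N by (auto intro: hausdorff_cover_mono ennreal_leI)
qed

text \<open>A single term is at most the whole sum, so a cover of total cost at most
  \<open>\<delta> powr s\<close> consists of sets of diameter at most \<delta>. Cheap covers are
  therefore admissible at every scale.\<close>

lemma hausdorff_measure_null:
  fixes E :: "'a::metric_space set"
  assumes "s > 0" "hausdorff_null s E"
  shows "hausdorff_measure s E = 0"
proof -
  have "hausdorff_premeasure s \<delta> E \<le> ennreal \<epsilon>" if "\<delta> > 0" "\<epsilon> > 0" for \<delta> \<epsilon>
  proof -
    define \<epsilon>' where "\<epsilon>' = min \<epsilon> (\<delta> powr s)"
    have "\<epsilon>' > 0" using that by (auto simp: \<epsilon>'_def)
    then have "hausdorff_cover s (ennreal \<epsilon>') E"
      using assms(2) by (auto simp: hausdorff_null_def)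
    then obtain U :: "nat \<Rightarrow> 'a set" where U: "\<And>i. bounded (U i)" "E \<subseteq> (\<Union>i. U i)"
      "(\<Sum>i. ennreal (diameter (U i) powr s)) \<le> ennreal \<epsilon>'"
      unfolding hausdorff_cover_def by blast
    have "diameter (U i) \<le> \<delta>" for i
    proof -
      have "(\<Sum>j\<in>{i}. ennreal (diameter (U j) powr s)) \<le> (\<Sum>j. ennreal (diameter (U j) powr s))"
        by (rule sum_le_suminf) (rule summableI, simp_all)
      then have "ennreal (diameter (U i) powr s) \<le> ennreal \<epsilon>'"
        using U(3) by (simp add: order_trans)
      then have "diameter (U i) powr s \<le> \<delta> powr s"
        using \<open>\<epsilon>' > 0\<close> by (simp add: \<epsilon>'_def)
      then show ?thesis
        using powr_less_mono2[OF assms(1) less_imp_le[OF that(1)], of "diameter (U i)"]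
        by (meson not_le)
    qed
    then have "hausdorff_premeasure s \<delta> E \<le> (\<Sum>i. ennreal (diameter (U i) powr s))"
      unfolding hausdorff_premeasure_def using U by (intro INF_lower) auto
    also have "\<dots> \<le> ennreal \<epsilon>"
      using U(3) by (rule order_trans) (auto simp: \<epsilon>'_def intro: ennreal_leI)
    finally show ?thesis .
  qed
  then have "hausdorff_premeasure s \<delta> E \<le> 0" if "\<delta> > 0" for \<delta>
    using that by (intro ennreal_le_epsilon[of 0]) simp
  then have "hausdorff_measure s E \<le> 0"
    unfolding hausdorff_measure_def by (intro SUP_least) simp
  then show ?thesis by simp
qed

section \<open>Distance to the nearest integer\<close>

lemma dist_int_eq: "dist_int y = \<bar>y - of_int (round y)\<bar>"
proof (rule antisym)
  show "dist_int y \<le> \<bar>y - of_int (round y)\<bar>"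
    unfolding dist_int_def using infdist_le[of "of_int (round y)" \<int> y] by (simp add: dist_real_def)
  have "(\<int>::real set) \<noteq> {}" using Ints_0 by blast
  then show "\<bar>y - of_int (round y)\<bar> \<le> dist_int y"
    unfolding dist_int_def
    by (simp add: infdist_notempty, intro cINF_greatest)
       (auto simp: dist_real_def elim!: Ints_cases intro: round_diff_minimal)
qed

lemma dist_int_le: "dist_int y \<le> \<bar>y - of_int n\<bar>"
  by (simp add: dist_int_eq round_diff_minimal)

lemma dist_int_nonneg: "dist_int y \<ge> 0"
  by (simp add: dist_int_eq)

lemma dist_int_le_half: "dist_int y \<le> 1/2"
  using of_int_round_abs_le[of y] by (simp add: dist_int_eq abs_minus_commute)

lemma dist_int_perturb: "dist_int x \<le> dist_int y + \<bar>x - y\<bar>"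
  using dist_int_le[of x "round y"] by (simp add: dist_int_eq[of y])

section \<open>Counting separated points\<close>

text \<open>Pigeonhole: \<open>f\<close> numbers the cells of length \<open>g\<close> that cover
  [-r, r], and two points in one cell would be closer than \<open>g\<close>.\<close>

lemma card_separated_le:
  fixes y :: "'a \<Rightarrow> real"
  assumes bd: "\<And>a. a \<in> P \<Longrightarrow> \<bar>y a\<bar> \<le> r"
    and sep: "\<And>a b. a \<in> P \<Longrightarrow> b \<in> P \<Longrightarrow> a \<noteq> b \<Longrightarrow> g \<le> \<bar>y a - y b\<bar>"
    and "g > 0" "r \<ge> 0"
  shows "real (card P) \<le> 2 * r / g + 1"
proof -
  define f where "f = (\<lambda>a. \<lfloor>(y a + r) / g\<rfloor>)"
  have "inj_on f P"
  proof (rule inj_onI, rule ccontr)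
    fix a b assume ab: "a \<in> P" "b \<in> P" "f a = f b" "a \<noteq> b"
    have "\<bar>(y a + r) / g - (y b + r) / g\<bar> < 1"
      using ab(3) unfolding f_def by linarith
    then have "\<bar>y a - y b\<bar> < g"
      using \<open>g > 0\<close> by (simp add: diff_divide_distrib[symmetric] abs_divide)
    then show False using sep[OF ab(1,2,4)] by simp
  qed
  moreover have "f ` P \<subseteq> {0..\<lfloor>2 * r / g\<rfloor>}"
  proof
    fix z assume "z \<in> f ` P"
    then obtain a where a: "a \<in> P" "z = f a" by blast
    have "0 \<le> (y a + r) / g" "(y a + r) / g \<le> 2 * r / g"
      using bd[OF a(1)] \<open>g > 0\<close> by (auto intro!: divide_nonneg_pos divide_right_mono)
    then show "z \<in> {0..\<lfloor>2 * r / g\<rfloor>}"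
      unfolding a(2) f_def by (auto intro: floor_mono)
  qed
  ultimately have "card P \<le> card {0..\<lfloor>2 * r / g\<rfloor>}"
    using card_inj_on_le by blast
  moreover have "real (card {0..\<lfloor>2 * r / g\<rfloor>}) \<le> 2 * r / g + 1"
    using assms(3,4) by simp
  ultimately show ?thesis by linarith
qed

text \<open>
  The differences of the points are bounded below only in product; fixing the range of all but one
  coordinate turns this into separation in the remaining coordinate.
\<close>

lemma card_gap_box_le:
  fixes \<beta> :: "'a \<Rightarrow> 'u::finite \<Rightarrow> real" and r :: "'u \<Rightarrow> real"
  assumes r: "\<And>u. r u > 0" and \<eta>: "\<eta> > 0"
    and box: "\<And>a u. a \<in> P \<Longrightarrow> dist_int (\<beta> a u) \<le> r u"
    and low: "\<And>a. a \<in> P \<Longrightarrow> \<eta> \<le> (\<Prod>u\<in>UNIV. dist_int (\<beta> a u))"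
    and sep: "\<And>a b. a \<in> P \<Longrightarrow> b \<in> P \<Longrightarrow> a \<noteq> b \<Longrightarrow> \<eta> \<le> (\<Prod>u\<in>UNIV. dist_int (\<beta> a u - \<beta> b u))"
  shows "real (card P) \<le> (2 ^ CARD('u) + 1) * (\<Prod>u\<in>UNIV. r u) / \<eta>"
proof (cases "P = {}")
  case True
  then show ?thesis using r \<eta> by (simp add: less_imp_le prod_nonneg)
next
  case False
  \<comment> \<open>The signed offset from the nearest integer turns the box condition into a bound
    on real numbers.\<close>
  define y where "y = (\<lambda>a u. \<beta> a u - of_int (round (\<beta> a u)))"
  have yr: "\<bar>y a u\<bar> \<le> r u" if "a \<in> P" for a u
    using box[OF that, of u] by (simp add: y_def dist_int_eq)
  have yd: "dist_int (\<beta> a u - \<beta> b u) \<le> \<bar>y a u - y b u\<bar>" for a b u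
    using dist_int_le[of "\<beta> a u - \<beta> b u" "round (\<beta> a u) - round (\<beta> b u)"]
    by (simp add: y_def algebra_simps)
  \<comment> \<open>The distinguished coordinate is arbitrary. The differences in each other
    coordinate are at most \<open>2 * r u\<close>, so the gap in the product leaves a gap
    \<open>\<eta> / W\<close> in coordinate \<open>u0\<close>.\<close>
  obtain u0 :: 'u where True by simp
  define W where "W = (\<Prod>u\<in>UNIV-{u0}. 2 * r u)"
  have W: "W > 0" unfolding W_def using r by (intro prod_pos) auto
  have prW: "2 * r u0 * W = 2 ^ CARD('u) * (\<Prod>u\<in>UNIV. r u)"
    unfolding W_def by (subst prod.remove[symmetric]) (auto simp: prod.distrib)
  have "real (card P) \<le> 2 * r u0 / (\<eta> / W) + 1"
  proof (rule card_separated_le[where y = "\<lambda>a. y a u0"])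
    fix a b assume ab: "a \<in> P" "b \<in> P" "a \<noteq> b"
    have "\<eta> \<le> (\<Prod>u\<in>UNIV. dist_int (\<beta> a u - \<beta> b u))" by (rule sep[OF ab])
    also have "\<dots> = dist_int (\<beta> a u0 - \<beta> b u0) * (\<Prod>u\<in>UNIV-{u0}. dist_int (\<beta> a u - \<beta> b u))"
      by (subst prod.remove[symmetric]) auto
    also have "\<dots> \<le> \<bar>y a u0 - y b u0\<bar> * W"
    proof (rule mult_mono)
      show "(\<Prod>u\<in>UNIV-{u0}. dist_int (\<beta> a u - \<beta> b u)) \<le> W"
        unfolding W_def
      proof (rule prod_mono)
        fix u
        have "\<bar>y a u - y b u\<bar> \<le> 2 * r u" using yr[OF ab(1), of u] yr[OF ab(2), of u] by linarith
        then show "0 \<le> dist_int (\<beta> a u - \<beta> b u) \<and> dist_int (\<beta> a u - \<beta> b u) \<le> 2 * r u"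
          using yd[of a u b] dist_int_nonneg by fastforce
      qed
    qed (auto simp: yd intro: prod_nonneg dist_int_nonneg)
    finally show "\<eta> / W \<le> \<bar>y a u0 - y b u0\<bar>" using W by (simp add: field_simps)
  qed (use yr W \<eta> r in \<open>auto simp: less_imp_le\<close>)
  also have "2 * r u0 / (\<eta> / W) = 2 ^ CARD('u) * (\<Prod>u\<in>UNIV. r u) / \<eta>"
    using prW by simp
  \<comment> \<open>Any point of \<open>P\<close> satisfies both \<open>low\<close> and
    \<open>box\<close>, so \<eta> is at most the volume of the box. This absorbs the additive 1 into
    the main term.\<close>
  also have "1 \<le> (\<Prod>u\<in>UNIV. r u) / \<eta>"
  proof -
    obtain a where "a \<in> P" using False by blast
    then have "\<eta> \<le> (\<Prod>u\<in>UNIV. r u)"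
      using low box by (intro order_trans[OF low prod_mono]) (auto simp: dist_int_nonneg)
    then show ?thesis using \<eta> by simp
  qed
  finally show ?thesis by (simp add: add_divide_distrib distrib_right)
qed

lemma dyadic_bracket:
  fixes x :: real
  assumes "1 \<le> x" "x \<le> 2 ^ L"
  obtains t where "t \<le> L" "2 ^ t \<le> x" "x \<le> 2 * 2 ^ t"
proof -
  define t where "t = (GREATEST t. t \<le> L \<and> 2 ^ t \<le> x)"
  have t: "t \<le> L \<and> 2 ^ t \<le> x"
    unfolding t_def by (rule GreatestI_nat[of _ 0 L]) (use assms in auto)
  moreover have "x \<le> 2 * 2 ^ t"
  proof (rule ccontr)
    assume "\<not> x \<le> 2 * 2 ^ t"
    then have *: "2 ^ Suc t < x" by simp
    then have "(2::real) ^ Suc t < 2 ^ L" using assms(2) by linarith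
    then have "Suc t \<le> L" using power_less_imp_less_exp[of "2::real" "Suc t" L] by simp
    then have "Suc t \<le> t"
      unfolding t_def using * by (intro Greatest_le_nat[of _ _ L]) (auto simp: t_def)
    then show False by simp
  qed
  ultimately show ?thesis using that by blast
qed

text \<open>Sort the points by the dyadic sizes \<open>2 ^ \<tau> u\<close> of their factors. The
  box count for one class is inversely proportional to the product of these sizes, so each class
  contributes the same bound, and only the number \<open>(L + 1) ^ CARD('u)\<close> of classes is
  lost.\<close>

lemma sum_gap_le:
  fixes \<beta> :: "'a \<Rightarrow> 'u::finite \<Rightarrow> real"
  assumes fin: "finite P" and T: "1 \<le> T" "T \<le> 2 ^ L" and \<eta>: "\<eta> > 0"
    and low: "\<And>a. a \<in> P \<Longrightarrow> \<eta> \<le> (\<Prod>u\<in>UNIV. dist_int (\<beta> a u))"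
    and sep: "\<And>a b. a \<in> P \<Longrightarrow> b \<in> P \<Longrightarrow> a \<noteq> b \<Longrightarrow> \<eta> \<le> (\<Prod>u\<in>UNIV. dist_int (\<beta> a u - \<beta> b u))"
  shows "(\<Sum>a\<in>P. \<Prod>u\<in>UNIV. min T (1 / dist_int (\<beta> a u)))
           \<le> (real L + 1) ^ CARD('u) * (2 ^ CARD('u) * (2 ^ CARD('u) + 1)) / \<eta>"
proof -
  define H where "H = (\<lambda>a u. min T (1 / dist_int (\<beta> a u)))"
  have pos: "dist_int (\<beta> a u) > 0" if "a \<in> P" for a u
  proof -
    have "(\<Prod>u\<in>UNIV. dist_int (\<beta> a u)) \<noteq> 0" using low[OF that] \<eta> by linarith
    then have "dist_int (\<beta> a u) \<noteq> 0" by simp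
    then show ?thesis using dist_int_nonneg[of "\<beta> a u"] by linarith
  qed
  have H: "1 \<le> H a u" "H a u \<le> 2 ^ L" if "a \<in> P" for a u
    using T pos[OF that, of u] dist_int_le_half[of "\<beta> a u"] by (auto simp: H_def)
  have "\<exists>t. a \<in> P \<longrightarrow> t \<le> L \<and> 2 ^ t \<le> H a u \<and> H a u \<le> 2 * 2 ^ t" for a u
    using H dyadic_bracket by metis
  then obtain t where t: "\<And>a u. a \<in> P \<Longrightarrow> t a u \<le> L \<and> 2 ^ t a u \<le> H a u \<and> H a u \<le> 2 * 2 ^ t a u"
    by metis
  define S where "S = Pi\<^sub>E (UNIV::'u set) (\<lambda>_. {..L})"
  have finS: "finite S" unfolding S_def by (rule finite_PiE) auto
  have cardS: "real (card S) = (real L + 1) ^ CARD('u)"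
    unfolding S_def by (simp add: card_PiE add.commute)
  have "(\<Sum>a\<in>P. \<Prod>u\<in>UNIV. H a u) = (\<Sum>\<tau>\<in>S. \<Sum>a\<in>{a\<in>P. t a = \<tau>}. \<Prod>u\<in>UNIV. H a u)"
    using fin finS t by (intro sum.group[symmetric]) (auto simp: S_def)
  also have "\<dots> \<le> (\<Sum>\<tau>\<in>S. 2 ^ CARD('u) * (2 ^ CARD('u) + 1) / \<eta>)"
  proof (rule sum_mono)
    fix \<tau> assume "\<tau> \<in> S"
    define B where "B = {a\<in>P. t a = \<tau>}"
    have cB: "real (card B) \<le> (2 ^ CARD('u) + 1) * (\<Prod>u\<in>UNIV. 1 / 2 ^ \<tau> u) / \<eta>"
    proof (rule card_gap_box_le)
      fix a u assume a: "a \<in> B"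
      have "2 ^ \<tau> u \<le> 1 / dist_int (\<beta> a u)" using a t[of a u] by (auto simp: B_def H_def)
      moreover have "dist_int (\<beta> a u) > 0" using a pos by (auto simp: B_def)
      ultimately show "dist_int (\<beta> a u) \<le> 1 / 2 ^ \<tau> u" by (simp add: field_simps)
    qed (use \<eta> low sep in \<open>auto simp: B_def\<close>)
    have "(\<Sum>a\<in>B. \<Prod>u\<in>UNIV. H a u) \<le> (\<Sum>a\<in>B. \<Prod>u\<in>UNIV. 2 * 2 ^ \<tau> u)"
      using t H by (intro sum_mono prod_mono) (auto simp: B_def intro: order_trans[OF zero_le_one])
    also have "\<dots> = real (card B) * (2 ^ CARD('u) * (\<Prod>u\<in>UNIV. 2 ^ \<tau> u))"
      by (simp add: prod.distrib)
    also have "\<dots> \<le> ((2 ^ CARD('u) + 1) * (\<Prod>u\<in>UNIV. 1 / 2 ^ \<tau> u) / \<eta>) * (2 ^ CARD('u) * (\<Prod>u\<in>UNIV. 2 ^ \<tau> u))"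
      using cB by (intro mult_right_mono) (auto intro!: mult_nonneg_nonneg prod_nonneg)
    also have "\<dots> = 2 ^ CARD('u) * (2 ^ CARD('u) + 1) / \<eta>"
      by (simp add: prod_dividef)
    finally show "(\<Sum>a\<in>{a\<in>P. t a = \<tau>}. \<Prod>u\<in>UNIV. H a u) \<le> 2 ^ CARD('u) * (2 ^ CARD('u) + 1) / \<eta>"
      by (simp add: B_def)
  qed
  also have "\<dots> = (real L + 1) ^ CARD('u) * (2 ^ CARD('u) * (2 ^ CARD('u) + 1)) / \<eta>"
    by (simp add: cardS)
  finally show ?thesis by (simp add: H_def)
qed

section \<open>Exponential sums\<close>

lemma cis_sum: "cis (sum f A) = (\<Prod>a\<in>A. cis (f a))"
  by (induction A rule: infinite_finite_induct) (auto simp: cis_mult[symmetric])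

text \<open>The left side of the chord identity |1 - cis (2x)| = 2 |sin x| is periodic, so
  \<open>x\<close> may be reduced to |x| at most pi/2, where |sin x| is at least |x|/2.\<close>

lemma norm_one_minus_cis_ge: "2 * dist_int t \<le> norm (1 - cis (2 * pi * t))"
proof -
  define x where "x = pi * (t - of_int (round t))"
  have "cis (2 * pi * t) = cis (2 * x + 2 * pi * of_int (round t))"
    by (simp add: x_def algebra_simps)
  also have "\<dots> = cis (2 * x)" by (simp add: cis_mult[symmetric])
  also have "1 - cis (2 * x) = - 2 * \<i> * of_real (sin x) * cis x"
    by (simp add: complex_eq_iff cos_double_sin sin_double power2_eq_square)
  finally have n: "norm (1 - cis (2 * pi * t)) = 2 * \<bar>sin x\<bar>"
    by (simp add: norm_mult)
  have d: "dist_int t = \<bar>x\<bar> / pi" by (simp add: x_def dist_int_eq abs_mult)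
  have "\<bar>x\<bar> \<le> pi / 2"
    using dist_int_le_half[of t] unfolding d by (simp add: field_simps)
  \<comment> \<open>Here 1.6 exceeds pi/2 while 1.6^2 is below 3, so the cubic Maclaurin error
    |x|^3/6 is at most |x|/2.\<close>
  then have "\<bar>x\<bar> \<le> 1.6" using pi_approx by simp
  then have "\<bar>x\<bar> ^ 2 \<le> 1.6 ^ 2" by (intro power_mono) auto
  also have "\<dots> \<le> (3::real)" by (simp add: power2_eq_square)
  finally have "\<bar>x\<bar> * \<bar>x\<bar>^2 \<le> \<bar>x\<bar> * 3" by (intro mult_left_mono) auto
  then have c: "\<bar>x\<bar> ^ 3 \<le> 3 * \<bar>x\<bar>" by (simp add: power3_eq_cube power2_eq_square)
  have "\<bar>sin x - x\<bar> \<le> \<bar>x\<bar> ^ 3 / 6"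
    using Maclaurin_sin_bound[of x 3]
    by (simp add: sin_coeff_def numeral_3_eq_3 fact_numeral)
  then have "\<bar>sin x\<bar> \<ge> \<bar>x\<bar> - \<bar>x\<bar> ^ 3 / 6" by linarith
  then have "\<bar>sin x\<bar> \<ge> \<bar>x\<bar> / 2" using c by linarith
  moreover have "\<bar>x\<bar> / pi \<le> \<bar>x\<bar> / 2" using pi_ge_two by (intro divide_left_mono) auto
  ultimately show ?thesis unfolding n d by linarith
qed

text \<open>The Dirichlet kernel of degree \<open>R\<close>, normalised to have period 1 in
  \<beta>.\<close>

definition dirichlet_sum :: "nat \<Rightarrow> real \<Rightarrow> complex" where
  "dirichlet_sum R \<beta> = (\<Sum>x\<in>{-int R..int R}. cis (2 * pi * (of_int x * \<beta>)))"

text \<open>The geometric sum, kept as a product so that it also covers integers \<beta>, where both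
  sides vanish.\<close>

lemma dirichlet_sum_telescope:
  "(1 - cis (2 * pi * \<beta>)) * dirichlet_sum R \<beta>
     = cis (- 2 * pi * (real R * \<beta>)) - cis (2 * pi * ((real R + 1) * \<beta>))"
proof (induction R)
  case 0
  then show ?case by (simp add: dirichlet_sum_def)
next
  case (Suc R)
  have "{-int (Suc R)..int (Suc R)} = insert (- int (Suc R)) (insert (int (Suc R)) {-int R..int R})"
    by auto
  then have "dirichlet_sum (Suc R) \<beta>
      = cis (- 2 * pi * ((real R + 1) * \<beta>)) + (cis (2 * pi * ((real R + 1) * \<beta>)) + dirichlet_sum R \<beta>)"
    by (simp add: dirichlet_sum_def algebra_simps)
  then have "(1 - cis (2 * pi * \<beta>)) * dirichlet_sum (Suc R) \<beta>
      = (1 - cis (2 * pi * \<beta>)) * cis (- 2 * pi * ((real R + 1) * \<beta>))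
        + (1 - cis (2 * pi * \<beta>)) * cis (2 * pi * ((real R + 1) * \<beta>))
        + (cis (- 2 * pi * (real R * \<beta>)) - cis (2 * pi * ((real R + 1) * \<beta>)))"
    by (simp only: distrib_left Suc.IH add.assoc)
  then show ?case
    by (simp add: left_diff_distrib cis_mult algebra_simps)
qed

lemma norm_dirichlet_sum_le: "norm (dirichlet_sum R \<beta>) \<le> 2 * real R + 1"
proof -
  have "norm (dirichlet_sum R \<beta>) \<le> (\<Sum>x\<in>{-int R..int R}. 1)"
    unfolding dirichlet_sum_def by (rule order_trans[OF norm_sum]) simp
  then show ?thesis by simp
qed

lemma norm_dirichlet_sum_le_inverse:
  assumes "dist_int \<beta> > 0"
  shows "norm (dirichlet_sum R \<beta>) \<le> 1 / dist_int \<beta>"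
proof -
  have "2 * dist_int \<beta> * norm (dirichlet_sum R \<beta>) \<le> norm ((1 - cis (2 * pi * \<beta>)) * dirichlet_sum R \<beta>)"
    unfolding norm_mult by (intro mult_right_mono norm_one_minus_cis_ge) auto
  also have "\<dots> \<le> 1 + 1"
    unfolding dirichlet_sum_telescope by (rule order_trans[OF norm_triangle_ineq4]) simp
  finally show ?thesis using assms by (simp add: field_simps)
qed

text \<open>If \<theta> is within \<open>1 / (6 * J)\<close> of an integer, all phases stay within
  pi/3 of 0, so every term has real part at least 1/2. For \<open>J = 1\<close> the sum is the
  single term 1, whatever \<theta> is.\<close>

lemma norm_cis_sum_ge:
  assumes "J = 1 \<or> dist_int \<theta> \<le> 1 / (6 * real J)" "J \<ge> 1"
  shows "real J / 2 \<le> norm (\<Sum>x\<in>{0..<int J}. cis (2 * pi * (of_int x * \<theta>)))"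
  using assms(1)
proof
  assume "J = 1"
  then have "{0..<int J} = {0}" by auto
  then show ?thesis using \<open>J = 1\<close> by simp
next
  assume le: "dist_int \<theta> \<le> 1 / (6 * real J)"
  define t where "t = \<theta> - of_int (round \<theta>)"
  have t: "\<bar>t\<bar> \<le> 1 / (6 * real J)" using le by (simp add: dist_int_eq t_def)
  have "1/2 \<le> Re (cis (2 * pi * (of_int x * \<theta>)))" if x: "x \<in> {0..<int J}" for x
  proof -
    have "cis (2 * pi * (of_int x * \<theta>)) = cis (2 * pi * (of_int x * t) + 2 * pi * of_int (x * round \<theta>))"
      by (simp add: t_def algebra_simps)
    also have "\<dots> = cis (2 * pi * (of_int x * t)) * cis (2 * pi * of_int (x * round \<theta>))"
      by (simp only: cis_mult)
    also have "cis (2 * pi * of_int (x * round \<theta>)) = 1"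
      by (rule cis_multiple_2pi) (rule Ints_of_int)
    finally have 1: "Re (cis (2 * pi * (of_int x * \<theta>))) = cos \<bar>2 * pi * (of_int x * t)\<bar>" by simp
    have "of_int x * \<bar>t\<bar> \<le> real J * (1 / (6 * real J))"
      using x t by (intro mult_mono) auto
    also have "\<dots> = 1/6" using assms(2) by simp
    finally have "of_int x * \<bar>t\<bar> \<le> 1/6" .
    then have "2 * pi * (of_int x * \<bar>t\<bar>) \<le> 2 * pi * (1/6)" by (intro mult_left_mono) auto
    then have "\<bar>2 * pi * (of_int x * t)\<bar> \<le> pi / 3" using x by (simp add: abs_mult)
    then have "cos (pi / 3) \<le> cos \<bar>2 * pi * (of_int x * t)\<bar>"
      by (intro cos_monotone_0_pi_le) auto
    then show ?thesis unfolding 1 by (simp add: cos_60)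
  qed
  then have "(\<Sum>x\<in>{0..<int J}. 1/2) \<le> (\<Sum>x\<in>{0..<int J}. Re (cis (2 * pi * (of_int x * \<theta>))))"
    by (rule sum_mono)
  also have "\<dots> \<le> norm (\<Sum>x\<in>{0..<int J}. cis (2 * pi * (of_int x * \<theta>)))"
    using complex_Re_le_cmod Re_sum by metis
  finally show ?thesis by simp
qed

section \<open>Counting integer points close to the lattice\<close>

lemma sum_PiE_cis:
  fixes c :: "'i::finite \<Rightarrow> real"
  assumes "finite X"
  shows "(\<Sum>a\<in>Pi\<^sub>E UNIV (\<lambda>_. X). cis (2 * pi * (\<Sum>i\<in>UNIV. of_int (a i) * c i)))
       = (\<Prod>i\<in>UNIV. \<Sum>x\<in>X. cis (2 * pi * (of_int x * c i)))"
  by (subst prod_sum_PiE) (auto simp: assms cis_sum sum_distrib_left)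

text \<open>
  Each counted point contributes at least \<open>(J/2)\<^sup>2\<^sup>m\<close> to the mean square of an exponential sum of
  Fejer type; the off-diagonal terms of the mean square are governed by the gap hypothesis.
\<close>

lemma card_near_lattice_le:
  fixes M :: "'u::finite \<Rightarrow> 'm::finite \<Rightarrow> real" and V :: "('u \<Rightarrow> int) set"
  assumes J: "J \<ge> 1" and V: "V \<subseteq> Pi\<^sub>E UNIV (\<lambda>_. {-int R..int R})"
    and near: "\<And>v i. v \<in> V \<Longrightarrow> J = 1 \<or> dist_int (\<Sum>u\<in>UNIV. of_int (v u) * M u i) \<le> 1 / (6 * real J)"
    and \<eta>: "\<eta> > 0"
    and gap: "\<And>j :: 'm \<Rightarrow> int. j \<noteq> (\<lambda>_. 0) \<Longrightarrow> (\<And>i. \<bar>j i\<bar> \<le> int J)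
                \<Longrightarrow> \<eta> \<le> (\<Prod>u\<in>UNIV. dist_int (\<Sum>i\<in>UNIV. of_int (j i) * M u i))"
    and L: "2 * real R + 1 \<le> 2 ^ L"
  shows "real (card V) * (real J / 2) ^ (2 * CARD('m)) \<le> real J ^ CARD('m) *
     ((2 * real R + 1) ^ CARD('u)
      + (real L + 1) ^ CARD('u) * (2 ^ CARD('u) * (2 ^ CARD('u) + 1)) / \<eta>)"
proof -
  define BJ where "BJ = Pi\<^sub>E (UNIV::'m set) (\<lambda>_. {0..<int J})"
  define BR where "BR = Pi\<^sub>E (UNIV::'u set) (\<lambda>_. {-int R..int R})"
  define T where "T = 2 * real R + 1"
  define \<theta> where "\<theta> = (\<lambda>(v::'u \<Rightarrow> int) i. \<Sum>u\<in>UNIV. of_int (v u) * M u i)"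
  define \<beta> where "\<beta> = (\<lambda>(j::'m \<Rightarrow> int) u. \<Sum>i\<in>UNIV. of_int (j i) * M u i)"
  define F where "F = (\<lambda>v. \<Sum>a\<in>BJ. cis (2 * pi * (\<Sum>i\<in>UNIV. of_int (a i) * \<theta> v i)))"
  have fin: "finite BJ" "finite BR" by (auto simp: BJ_def BR_def intro!: finite_PiE)
  have cardBJ: "card BJ = J ^ CARD('m)" by (simp add: BJ_def card_PiE)
  have \<beta>_diff: "\<beta> (\<lambda>i. a i - b i) u = \<beta> a u - \<beta> b u" for a b u
    by (simp add: \<beta>_def left_diff_distrib sum_subtractf)
  \<comment> \<open>Duality: pairing \<open>a\<close> with \<open>v M\<close> is pairing
    \<open>v\<close> with \<open>M a\<close>. Hence the mean square over \<open>v\<close> factors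
    into Dirichlet kernels at \<open>\<beta> a u - \<beta> b u\<close>.\<close>
  have swap: "(\<Sum>i\<in>UNIV. of_int (a i) * \<theta> v i) = (\<Sum>u\<in>UNIV. of_int (v u) * \<beta> a u)" for a v
    unfolding \<theta>_def \<beta>_def sum_distrib_left by (subst sum.swap) (simp add: mult.left_commute)
  have F_ge: "(real J / 2) ^ (2 * CARD('m)) \<le> (norm (F v))\<^sup>2" if "v \<in> V" for v
  proof -
    have "F v = (\<Prod>i\<in>UNIV. \<Sum>x\<in>{0..<int J}. cis (2 * pi * (of_int x * \<theta> v i)))"
      unfolding F_def BJ_def by (rule sum_PiE_cis) simp
    then have "norm (F v) = (\<Prod>i\<in>UNIV. norm (\<Sum>x\<in>{0..<int J}. cis (2 * pi * (of_int x * \<theta> v i))))"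
      by (simp add: prod_norm)
    also have "\<dots> \<ge> (\<Prod>i\<in>(UNIV::'m set). real J / 2)"
      using near[OF that] J by (intro prod_mono conjI norm_cis_sum_ge) (auto simp: \<theta>_def)
    finally have "(real J / 2) ^ CARD('m) \<le> norm (F v)" by simp
    then have "((real J / 2) ^ CARD('m))\<^sup>2 \<le> (norm (F v))\<^sup>2" by (intro power_mono) auto
    then show ?thesis by (simp add: power_mult[symmetric] mult.commute)
  qed
  have F_sq: "complex_of_real ((norm (F v))\<^sup>2)
      = (\<Sum>a\<in>BJ. \<Sum>b\<in>BJ. cis (2 * pi * (\<Sum>u\<in>UNIV. of_int (v u) * (\<beta> a u - \<beta> b u))))" for v
  proof -
    have "complex_of_real ((norm (F v))\<^sup>2) = F v * cnj (F v)"
      by (rule complex_norm_square)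
    also have "\<dots> = (\<Sum>a\<in>BJ. \<Sum>b\<in>BJ. cis (2 * pi * (\<Sum>i\<in>UNIV. of_int (a i) * \<theta> v i))
                        * cis (- (2 * pi * (\<Sum>i\<in>UNIV. of_int (b i) * \<theta> v i))))"
      unfolding F_def by (simp add: sum_product cis_cnj)
    also have "\<dots> = (\<Sum>a\<in>BJ. \<Sum>b\<in>BJ. cis (2 * pi * (\<Sum>u\<in>UNIV. of_int (v u) * (\<beta> a u - \<beta> b u))))"
      by (simp add: cis_mult swap right_diff_distrib sum_subtractf)
    finally show ?thesis .
  qed
  have "complex_of_real (\<Sum>v\<in>BR. (norm (F v))\<^sup>2) = (\<Sum>v\<in>BR. complex_of_real ((norm (F v))\<^sup>2))"
    by simp
  also have "\<dots> = (\<Sum>v\<in>BR. \<Sum>a\<in>BJ. \<Sum>b\<in>BJ. cis (2 * pi * (\<Sum>u\<in>UNIV. of_int (v u) * (\<beta> a u - \<beta> b u))))"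
    by (simp only: F_sq)
  also have "\<dots> = (\<Sum>a\<in>BJ. \<Sum>v\<in>BR. \<Sum>b\<in>BJ. cis (2 * pi * (\<Sum>u\<in>UNIV. of_int (v u) * (\<beta> a u - \<beta> b u))))"
    by (rule sum.swap)
  also have "\<dots> = (\<Sum>a\<in>BJ. \<Sum>b\<in>BJ. \<Sum>v\<in>BR. cis (2 * pi * (\<Sum>u\<in>UNIV. of_int (v u) * (\<beta> a u - \<beta> b u))))"
    by (intro sum.cong refl sum.swap)
  also have "\<dots> = (\<Sum>a\<in>BJ. \<Sum>b\<in>BJ. \<Prod>u\<in>UNIV. dirichlet_sum R (\<beta> a u - \<beta> b u))"
    unfolding BR_def dirichlet_sum_def by (simp add: sum_PiE_cis)
  finally have sum_eq: "complex_of_real (\<Sum>v\<in>BR. (norm (F v))\<^sup>2)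
      = (\<Sum>a\<in>BJ. \<Sum>b\<in>BJ. \<Prod>u\<in>UNIV. dirichlet_sum R (\<beta> a u - \<beta> b u))" .
  define S where "S = (real L + 1) ^ CARD('u) * (2 ^ CARD('u) * (2 ^ CARD('u) + 1)) / \<eta>"
  have gapJ: "\<eta> \<le> (\<Prod>u\<in>UNIV. dist_int (\<beta> a u - \<beta> b u))" if "a \<in> BJ" "b \<in> BJ" "a \<noteq> b" for a b
  proof -
    have "\<bar>a i - b i\<bar> \<le> int J" for i
    proof -
      have "a i \<in> {0..<int J}" "b i \<in> {0..<int J}" using that by (auto simp: BJ_def)
      then show ?thesis by auto
    qed
    moreover have "(\<lambda>i. a i - b i) \<noteq> (\<lambda>_. 0)" using \<open>a \<noteq> b\<close> by (auto simp: fun_eq_iff)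
    ultimately have "\<eta> \<le> (\<Prod>u\<in>UNIV. dist_int (\<beta> (\<lambda>i. a i - b i) u))"
      using gap[of "\<lambda>i. a i - b i"] by (simp add: \<beta>_def)
    then show ?thesis by (simp add: \<beta>_diff)
  qed
  have inner: "norm (\<Sum>b\<in>BJ. \<Prod>u\<in>UNIV. dirichlet_sum R (\<beta> a u - \<beta> b u)) \<le> T ^ CARD('u) + S"
    if a: "a \<in> BJ" for a
  proof -
    have "norm (\<Sum>b\<in>BJ. \<Prod>u\<in>UNIV. dirichlet_sum R (\<beta> a u - \<beta> b u))
        \<le> (\<Sum>b\<in>BJ. \<Prod>u\<in>UNIV. norm (dirichlet_sum R (\<beta> a u - \<beta> b u)))"
      by (rule order_trans[OF norm_sum]) (simp add: prod_norm)
    \<comment> \<open>The diagonal term \<open>b = a\<close> yields the main term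
      \<open>T ^ CARD('u)\<close>; the gap hypothesis controls the remaining ones.\<close>
    also have "\<dots> = (\<Prod>u\<in>UNIV. norm (dirichlet_sum R (\<beta> a u - \<beta> a u)))
        + (\<Sum>b\<in>BJ-{a}. \<Prod>u\<in>UNIV. norm (dirichlet_sum R (\<beta> a u - \<beta> b u)))"
      using fin a by (simp add: sum.remove)
    also have "\<dots> \<le> T ^ CARD('u) + S"
    proof (rule add_mono)
      have "(\<Prod>u\<in>UNIV. norm (dirichlet_sum R (\<beta> a u - \<beta> a u))) \<le> (\<Prod>u\<in>(UNIV::'u set). T)"
        by (intro prod_mono) (auto simp: T_def norm_dirichlet_sum_le)
      then show "(\<Prod>u\<in>UNIV. norm (dirichlet_sum R (\<beta> a u - \<beta> a u))) \<le> T ^ CARD('u)" by simp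
      have "(\<Sum>b\<in>BJ-{a}. \<Prod>u\<in>UNIV. norm (dirichlet_sum R (\<beta> a u - \<beta> b u)))
          \<le> (\<Sum>b\<in>BJ-{a}. \<Prod>u\<in>UNIV. min T (1 / dist_int (\<beta> a u - \<beta> b u)))"
      proof (intro sum_mono prod_mono conjI)
        fix b u assume b: "b \<in> BJ - {a}"
        have "(\<Prod>u\<in>UNIV. dist_int (\<beta> a u - \<beta> b u)) \<noteq> 0"
          using gapJ[of a b] a b \<eta> by force
        then have "dist_int (\<beta> a u - \<beta> b u) \<noteq> 0" by simp
        then have "dist_int (\<beta> a u - \<beta> b u) > 0"
          using dist_int_nonneg[of "\<beta> a u - \<beta> b u"] by linarith
        then show "norm (dirichlet_sum R (\<beta> a u - \<beta> b u)) \<le> min T (1 / dist_int (\<beta> a u - \<beta> b u))"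
          by (simp add: T_def norm_dirichlet_sum_le norm_dirichlet_sum_le_inverse)
      qed auto
      also have "\<dots> \<le> S"
        unfolding S_def
      proof (rule sum_gap_le)
        \<comment> \<open>Subtracting two members of the family cancels the base \<open>a\<close>
          and leaves again a difference of frequencies in \<open>BJ\<close>, so \<open>gapJ\<close>
          also provides the separation.\<close>
        fix b c assume "b \<in> BJ - {a}" "c \<in> BJ - {a}" "b \<noteq> c"
        then have "\<eta> \<le> (\<Prod>u\<in>UNIV. dist_int (\<beta> c u - \<beta> b u))" using gapJ[of c b] by auto
        then show "\<eta> \<le> (\<Prod>u\<in>UNIV. dist_int (\<beta> a u - \<beta> b u - (\<beta> a u - \<beta> c u)))" by simp
      qed (use fin \<eta> L gapJ[OF a] in \<open>auto simp: T_def\<close>)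
      finally show "(\<Sum>b\<in>BJ-{a}. \<Prod>u\<in>UNIV. norm (dirichlet_sum R (\<beta> a u - \<beta> b u))) \<le> S" .
    qed
    finally show ?thesis .
  qed
  have "real (card V) * (real J / 2) ^ (2 * CARD('m)) = (\<Sum>v\<in>V. (real J / 2) ^ (2 * CARD('m)))"
    by simp
  also have "\<dots> \<le> (\<Sum>v\<in>V. (norm (F v))\<^sup>2)" by (intro sum_mono F_ge)
  \<comment> \<open>All terms are non-negative, so \<open>V\<close> may be enlarged to the full box,
    over which the sum can be evaluated.\<close>
  also have "\<dots> \<le> (\<Sum>v\<in>BR. (norm (F v))\<^sup>2)"
    using fin V by (intro sum_mono2) (auto simp: BR_def)
  also have "\<dots> \<le> norm (complex_of_real (\<Sum>v\<in>BR. (norm (F v))\<^sup>2))"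
    unfolding norm_of_real by (rule abs_ge_self)
  also have "\<dots> \<le> (\<Sum>a\<in>BJ. norm (\<Sum>b\<in>BJ. \<Prod>u\<in>UNIV. dirichlet_sum R (\<beta> a u - \<beta> b u)))"
    unfolding sum_eq by (rule norm_sum)
  also have "\<dots> \<le> (\<Sum>a\<in>BJ. T ^ CARD('u) + S)" by (intro sum_mono inner)
  also have "\<dots> = real J ^ CARD('m) * (T ^ CARD('u) + S)" by (simp add: cardBJ)
  finally show ?thesis by (simp add: T_def S_def)
qed

section \<open>Lower bounds from the multiplicative exponent\<close>

text \<open>For \<open>w\<close> above the exponent only finitely many integer vectors violate the
  bound with constant 1, so a smaller constant serves all nonzero ones. Any \<open>X\<close> above
  the sup norm is allowed because \<open>X powr (-w)\<close> decreases in \<open>X\<close>.\<close>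

lemma mult_exponent_gap:
  fixes M :: "real ^ 'm ^ 'l"
  assumes w: "mult_exponent M < ereal w" "w > 0"
  obtains c where "c > 0"
    and "\<forall>(j :: 'm \<Rightarrow> int) X. j \<noteq> (\<lambda>_. 0) \<longrightarrow> (\<forall>i. \<bar>real_of_int (j i)\<bar> \<le> X) \<longrightarrow>
           c * X powr (-w) \<le> (\<Prod>u\<in>UNIV. dist_int (\<Sum>i\<in>UNIV. of_int (j i) * M $ u $ i))"
proof -
  define P where "P = (\<lambda>j :: real ^ 'm. \<Prod>u\<in>UNIV. dist_int (j \<bullet> row u M))"
  define B where "B = {j :: real ^ 'm. (\<forall>k. j $ k \<in> \<int>) \<and> P j < infnorm j powr (- w)}"
  have finB: "finite B"
  proof (rule ccontr)
    assume "infinite B"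
    then have "ereal w \<le> mult_exponent M"
      unfolding mult_exponent_def B_def P_def by (intro Sup_upper) auto
    then show False using w(1) by simp
  qed
  have P_nonneg: "P j \<ge> 0" for j unfolding P_def by (intro prod_nonneg) (auto simp: dist_int_nonneg)
  \<comment> \<open>If the product vanished at \<open>j\<close>, some factor would vanish at
    \<open>j\<close> and hence at all multiples of \<open>j\<close>, putting infinitely many vectors
    into \<open>B\<close>.\<close>
  have P_pos: "P j > 0" if j: "j \<noteq> 0" "\<And>k. j $ k \<in> \<int>" for j
  proof (rule ccontr)
    assume "\<not> P j > 0"
    then have "P j = 0" using P_nonneg[of j] by linarith
    then obtain u where "dist_int (j \<bullet> row u M) = 0" by (auto simp: P_def)
    then have u: "j \<bullet> row u M = of_int (round (j \<bullet> row u M))" by (simp add: dist_int_eq)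
    have "real (Suc k) *\<^sub>R j \<in> B" for k
    proof -
      have "(real (Suc k) *\<^sub>R j) \<bullet> row u M = of_int (int (Suc k) * round (j \<bullet> row u M))"
        using u by (simp add: inner_scaleR_left)
      then have "dist_int ((real (Suc k) *\<^sub>R j) \<bullet> row u M) = 0"
        by (simp only: dist_int_eq round_of_int)
      then have "P (real (Suc k) *\<^sub>R j) = 0" unfolding P_def by (intro prod_zero) auto
      moreover have "infnorm (real (Suc k) *\<^sub>R j) > 0"
        using j(1) by (simp add: infnorm_pos_lt)
      moreover have "(real (Suc k) *\<^sub>R j) $ i \<in> \<int>" for i
        using j(2)[of i] by (simp add: Ints_mult Ints_add del: of_nat_Suc)
      ultimately show ?thesis by (auto simp: B_def)
    qed
    then have "range (\<lambda>k. real (Suc k) *\<^sub>R j) \<subseteq> B" by blast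
    moreover have "inj (\<lambda>k. real (Suc k) *\<^sub>R j)" using j(1) by (auto simp: inj_def)
    ultimately show False using finB by (meson finite_imageD finite_subset infinite_UNIV_nat)
  qed
  \<comment> \<open>The entry 1 serves the vectors outside \<open>B\<close>; the other entries are
    the ratios at the finitely many exceptions, positive by \<open>P_pos\<close>.\<close>
  define c where "c = Min (insert 1 ((\<lambda>j. P j * infnorm j powr w) ` (B - {0})))"
  have "c > 0"
    unfolding c_def using finB P_pos by (subst Min_gr_iff) (auto simp: B_def infnorm_eq_0)
  moreover have "c * X powr (-w) \<le> (\<Prod>u\<in>UNIV. dist_int (\<Sum>i\<in>UNIV. of_int (j i) * M $ u $ i))"
    if j: "j \<noteq> (\<lambda>_. 0)" "\<And>i. \<bar>real_of_int (j i)\<bar> \<le> X" for j :: "'m \<Rightarrow> int" and X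
  proof -
    define y :: "real ^ 'm" where "y = (\<chi> i. of_int (j i))"
    have "y \<noteq> 0" using j(1) by (auto simp: y_def vec_eq_iff)
    then have ypos: "infnorm y > 0" by (simp add: infnorm_pos_lt)
    have "infnorm y \<le> X"
      unfolding infnorm_cart using j(2) by (intro cSup_least) (auto simp: y_def)
    then have "X powr (-w) \<le> infnorm y powr (-w)"
      using ypos w(2) by (intro powr_mono2') auto
    then have "c * X powr (-w) \<le> c * infnorm y powr (-w)"
      using \<open>c > 0\<close> by simp
    also have "\<dots> \<le> P y"
    proof (cases "y \<in> B")
      case True
      then have "c \<le> P y * infnorm y powr w"
        unfolding c_def using finB \<open>y \<noteq> 0\<close> by (intro Min_le) auto
      then have "c * infnorm y powr (-w) \<le> P y * infnorm y powr w * infnorm y powr (-w)"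
        by (intro mult_right_mono) auto
      also have "\<dots> = P y" using ypos by (simp add: powr_minus field_simps)
      finally show ?thesis .
    next
      case False
      have "c \<le> 1" unfolding c_def using finB by (intro Min_le) auto
      then have "c * infnorm y powr (-w) \<le> infnorm y powr (-w)" by (intro mult_left_le_one_le) (use \<open>c > 0\<close> in auto)
      also have "\<dots> \<le> P y" using False by (auto simp: B_def y_def)
      finally show ?thesis .
    qed
    also have "P y = (\<Prod>u\<in>UNIV. dist_int (\<Sum>i\<in>UNIV. of_int (j i) * M $ u $ i))"
      by (simp add: P_def y_def inner_vec_def row_def)
    finally show ?thesis .
  qed
  ultimately show ?thesis using that by blast
qed

section \<open>Counting near-lattice points on dyadic scales\<close>

lemma linear_le_exponential:
  fixes b a :: real
  assumes "b > 1" "a \<ge> 0"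
  shows "real k + a \<le> (1 / (b - 1) + a) * b ^ k"
proof -
  have "1 + real k * (b - 1) \<le> b ^ k"
    using Bernoulli_inequality[of "b - 1" k] assms by simp
  then have "real k \<le> 1 / (b - 1) * b ^ k" using assms by (simp add: field_simps)
  moreover have "a * 1 \<le> a * b ^ k" using assms by (intro mult_left_mono) auto
  ultimately show ?thesis by (simp add: distrib_right)
qed

text \<open>With \<open>R = K * 2 ^ k\<close> and \<open>J\<close> of order 1/\<delta> (or 1), the
  diagonal part of the count has order \<open>2 ^ (k * CARD('u))\<close>. The rest has order
  \<open>k ^ CARD('u) * J powr w\<close>, and \<open>J\<close> is at most
  \<open>2 powr (\<tau> * k)\<close>; since \<open>w * \<tau> < CARD('u)\<close>, the power of
  \<open>k\<close> is absorbed.\<close>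

lemma card_near_lattice_dyadic:
  fixes M :: "real ^ ('m::finite) ^ ('u::finite)"
  assumes exp: "mult_exponent M < ereal w" "w > 0" and \<tau>: "\<tau> > 0" "w * \<tau> < CARD('u)"
    and K: "K \<ge> 1"
  obtains C where "C > 0"
    and "\<forall>k \<delta>. 2 powr (- \<tau> * real k) \<le> \<delta> \<longrightarrow>
       real (card {v \<in> Pi\<^sub>E UNIV (\<lambda>_. {-int (K * 2^k)..int (K * 2^k)}).
          \<forall>i. dist_int (\<Sum>u\<in>UNIV. of_int (v u) * M $ u $ i) \<le> \<delta>}) \<le> C * \<delta> ^ CARD('m) * 2 ^ (k * CARD('u))"
proof -
  define m where "m = CARD('m)"
  define D where "D = CARD('u)"
  have D: "D > 0" by (simp add: D_def)
  obtain c where c: "c > 0"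
    and gap: "\<forall>(j :: 'm \<Rightarrow> int) X. j \<noteq> (\<lambda>_. 0) \<longrightarrow> (\<forall>i. \<bar>real_of_int (j i)\<bar> \<le> X) \<longrightarrow>
           c * X powr (-w) \<le> (\<Prod>u\<in>UNIV. dist_int (\<Sum>i\<in>UNIV. of_int (j i) * M $ u $ i))"
    using mult_exponent_gap[OF exp] by blast
  obtain L0 where L0: "3 * real K \<le> 2 ^ L0"
    using real_arch_pow[of 2 "3 * real K"] by (auto intro: less_imp_le)
  \<comment> \<open>Chosen so that \<open>b ^ D * 2 powr (w * \<tau>) = 2 ^ D\<close>: the slack
    \<open>D - w * \<tau>\<close>, spread over \<open>D\<close> factors, pays for the logarithmic
    factors through \<open>linear_le_exponential\<close>.\<close>
  define b where "b = 2 powr ((D - w * \<tau>) / D)"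
  have b: "b > 1" unfolding b_def using \<tau>(2) D by (simp add: D_def)
  define A where "A = (1 / (b - 1) + (real L0 + 1)) ^ D * (2 ^ D * (2 ^ D + 1)) / c"
  have A: "A > 0" unfolding A_def using b c by (intro divide_pos_pos mult_pos_pos zero_less_power) (auto intro: add_pos_pos)
  \<comment> \<open>\<open>4 ^ m\<close> comes from dividing by \<open>(J / 2) ^ (2 * m)\<close>,
    \<open>12 ^ m\<close> from bounding 1/J by \<open>12 * \<delta>\<close>, and the two summands
    from the diagonal and off-diagonal parts.\<close>
  define C where "C = 4 ^ m * 12 ^ m * ((3 * real K) ^ D + A)"
  have "C > 0" unfolding C_def using A K by (auto intro!: mult_pos_pos add_nonneg_pos)
  moreover have "real (card {v \<in> Pi\<^sub>E UNIV (\<lambda>_. {-int (K * 2^k)..int (K * 2^k)}).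
          \<forall>i. dist_int (\<Sum>u\<in>UNIV. of_int (v u) * M $ u $ i) \<le> \<delta>}) \<le> C * \<delta> ^ m * 2 ^ (k * D)"
    if \<delta>: "2 powr (- \<tau> * real k) \<le> \<delta>" for k \<delta>
  proof -
    define V where "V = {v \<in> Pi\<^sub>E (UNIV::'u set) (\<lambda>_. {-int (K * 2^k)..int (K * 2^k)}).
          \<forall>i. dist_int (\<Sum>u\<in>UNIV. of_int (v u) * M $ u $ i) \<le> \<delta>}"
    have \<delta>0: "\<delta> > 0" by (rule less_le_trans[OF _ \<delta>]) simp
    have \<delta>1: "1 / \<delta> \<le> 2 powr (\<tau> * real k)"
      using \<delta> \<delta>0 by (simp add: powr_minus field_simps)
    \<comment> \<open>Rounding down a number that is at least 1 loses at most a factor 2, which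
      turns 6 into 12. For \<delta> above 1/6 the trivial case \<open>J = 1\<close> of the counting
      bound takes over.\<close>
    define J where "J = (if 6 * \<delta> \<le> 1 then nat \<lfloor>1 / (6 * \<delta>)\<rfloor> else 1)"
    have J: "J \<ge> 1" "J = 1 \<or> \<delta> \<le> 1 / (6 * real J)" "1 / real J \<le> 12 * \<delta>" "real J \<le> 2 powr (\<tau> * real k)"
    proof -
      have "J \<ge> 1 \<and> (J = 1 \<or> \<delta> \<le> 1 / (6 * real J)) \<and> 1 / real J \<le> 12 * \<delta> \<and> real J \<le> 2 powr (\<tau> * real k)"
      proof (cases "6 * \<delta> \<le> 1")
        case True
        define x where "x = 1 / (6 * \<delta>)"
        have x: "x \<ge> 1" using True \<delta>0 by (simp add: x_def)
        have JJ: "J = nat \<lfloor>x\<rfloor>" using True by (simp add: J_def x_def)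
        have J1: "real J \<le> x" "x / 2 \<le> real J" "J \<ge> 1"
        proof -
          have f: "1 \<le> \<lfloor>x\<rfloor>" using x by simp
          then have "real J = of_int \<lfloor>x\<rfloor>" by (simp add: JJ)
          moreover have "1 \<le> real_of_int \<lfloor>x\<rfloor>" using f by simp
          ultimately show "real J \<le> x" "x / 2 \<le> real J" "J \<ge> 1" by linarith+
        qed
        have "\<delta> \<le> 1 / (6 * real J)" using J1 \<delta>0 by (simp add: x_def field_simps)
        moreover have "1 / real J \<le> 12 * \<delta>" using J1 \<delta>0 by (simp add: x_def field_simps)
        moreover have "x \<le> 1 / \<delta>" using \<delta>0 by (simp add: x_def field_simps)
        ultimately show ?thesis using J1 \<delta>1 by linarith
      next
        case False
        have "1 \<le> 2 powr (\<tau> * real k)" using \<tau> by (intro ge_one_powr_ge_zero) auto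
        then show ?thesis using False by (auto simp: J_def)
      qed
      then show "J \<ge> 1" "J = 1 \<or> \<delta> \<le> 1 / (6 * real J)" "1 / real J \<le> 12 * \<delta>" "real J \<le> 2 powr (\<tau> * real k)"
        by auto
    qed
    define \<eta> where "\<eta> = c * real J powr (-w)"
    have \<eta>: "\<eta> > 0" using c J(1) by (simp add: \<eta>_def)
    define T where "T = 2 * real (K * 2 ^ k) + 1"
    have T: "0 \<le> T" "T \<le> 3 * real K * 2 ^ k"
    proof -
      have "1 * 1 \<le> real K * 2 ^ k" using K by (intro mult_mono) auto
      then show "0 \<le> T" "T \<le> 3 * real K * 2 ^ k" by (auto simp: T_def)
    qed
    have TL: "T \<le> 2 ^ (k + L0)"
      using T(2) L0 by (rule_tac order_trans) (auto simp: power_add mult.commute)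
    have "real (card V) * (real J / 2) ^ (2 * CARD('m)) \<le> real J ^ CARD('m) *
       ((2 * real (K * 2 ^ k) + 1) ^ CARD('u)
        + (real (k + L0) + 1) ^ CARD('u) * (2 ^ CARD('u) * (2 ^ CARD('u) + 1)) / \<eta>)"
    proof (rule card_near_lattice_le[where M = "\<lambda>u i. M $ u $ i", OF J(1) _ _ \<eta>])
      fix v i assume "v \<in> V"
      then show "J = 1 \<or> dist_int (\<Sum>u\<in>UNIV. of_int (v u) * M $ u $ i) \<le> 1 / (6 * real J)"
        using J(2) by (auto simp: V_def intro: order_trans)
    next
      fix j :: "'m \<Rightarrow> int" assume j: "j \<noteq> (\<lambda>_. 0)" "\<And>i. \<bar>j i\<bar> \<le> int J"
      have "\<bar>real_of_int (j i)\<bar> \<le> real J" for i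
        using j(2)[of i] by linarith
      then show "\<eta> \<le> (\<Prod>u\<in>UNIV. dist_int (\<Sum>i\<in>UNIV. of_int (j i) * M $ u $ i))"
        unfolding \<eta>_def using gap j(1) by blast
    qed (use TL in \<open>auto simp: V_def T_def\<close>)
    then have main: "real (card V) * (real J / 2) ^ (2 * m) \<le> real J ^ m *
       (T ^ D + (real k + (real L0 + 1)) ^ D * (2 ^ D * (2 ^ D + 1)) / \<eta>)"
      unfolding m_def[symmetric] D_def[symmetric] T_def[symmetric] by (simp add: add.assoc)
    have e1: "T ^ D \<le> (3 * real K) ^ D * 2 ^ (k * D)"
      using power_mono[OF T(2,1), of D] by (simp add: power_mult_distrib power_mult)
    have "(real k + (real L0 + 1)) ^ D \<le> ((1 / (b - 1) + (real L0 + 1)) * b ^ k) ^ D"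
      by (intro power_mono linear_le_exponential b) auto
    also have "\<dots> = (1 / (b - 1) + (real L0 + 1)) ^ D * (b ^ D) ^ k"
      by (simp only: power_mult_distrib power_mult[symmetric] mult.commute)
    also have "b ^ D = 2 powr (D - w * \<tau>)"
      using D by (simp add: b_def powr_power)
    finally have e2: "(real k + (real L0 + 1)) ^ D
        \<le> (1 / (b - 1) + (real L0 + 1)) ^ D * (2 powr (D - w * \<tau>)) ^ k" .
    have "1 / \<eta> = real J powr w / c" using J(1) c by (simp add: \<eta>_def powr_minus field_simps)
    also have "\<dots> \<le> (2 powr (\<tau> * real k)) powr w / c"
      using J(4) exp(2) c by (intro divide_right_mono powr_mono2) auto
    also have "\<dots> = (2 powr (w * \<tau>)) ^ k / c"
      by (simp add: powr_powr powr_power mult_ac)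
    finally have e3: "1 / \<eta> \<le> (2 powr (w * \<tau>)) ^ k / c" .
    have "(real k + (real L0 + 1)) ^ D * (2 ^ D * (2 ^ D + 1)) / \<eta>
        = (real k + (real L0 + 1)) ^ D * (1 / \<eta>) * (2 ^ D * (2 ^ D + 1))" by simp
    also have "\<dots> \<le> ((1 / (b - 1) + (real L0 + 1)) ^ D * (2 powr (D - w * \<tau>)) ^ k) * ((2 powr (w * \<tau>)) ^ k / c)
        * (2 ^ D * (2 ^ D + 1))"
      using e2 e3 \<eta> b by (intro mult_right_mono mult_mono) auto
    also have "\<dots> = A * ((2 powr (D - w * \<tau>)) * (2 powr (w * \<tau>))) ^ k"
      by (simp add: A_def power_mult_distrib)
    also have "(2 powr (D - w * \<tau>)) * (2 powr (w * \<tau>)) = 2 ^ D"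
      by (simp add: powr_add[symmetric] powr_realpow)
    also have "(2 ^ D) ^ k = (2::real) ^ (k * D)"
      by (simp add: power_mult[symmetric] mult.commute)
    finally have e4: "(real k + (real L0 + 1)) ^ D * (2 ^ D * (2 ^ D + 1)) / \<eta> \<le> A * 2 ^ (k * D)" .
    have "real (card V) = real (card V) * (real J / 2) ^ (2 * m) * (4 ^ m * (1 / real J) ^ (2 * m))"
      using J(1) by (simp add: power_divide power_mult)
    also have "\<dots> \<le> real J ^ m * ((3 * real K) ^ D * 2 ^ (k * D) + A * 2 ^ (k * D))
         * (4 ^ m * (1 / real J) ^ (2 * m))"
      using order_trans[OF main mult_left_mono[OF add_mono[OF e1 e4]]]
      by (intro mult_right_mono) auto
    also have "\<dots> = 4 ^ m * ((3 * real K) ^ D + A) * 2 ^ (k * D) * (1 / real J) ^ m"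
    proof -
      have "real J ^ m * (1 / real J) ^ (2 * m) = (1 / real J) ^ m"
        using J(1) by (simp add: mult_2 power_add power_divide)
      moreover have "j * (P * t + Q * t) * (z * i) = z * (P + Q) * t * (j * i)" for j P t Q z i :: real
        by (simp add: algebra_simps)
      ultimately show ?thesis by (simp only:)
    qed
    also have "\<dots> \<le> 4 ^ m * ((3 * real K) ^ D + A) * 2 ^ (k * D) * (12 * \<delta>) ^ m"
      using J(3) A by (intro mult_left_mono power_mono) auto
    also have "\<dots> = C * \<delta> ^ m * 2 ^ (k * D)" by (simp add: C_def power_mult_distrib)
    finally show ?thesis unfolding V_def .
  qed
  ultimately show ?thesis using that[of C] unfolding m_def D_def by blast
qed

section \<open>Summation over dyadic blocks\<close>

text \<open>Cauchy condensation with the weight \<open>q powr e\<close>: on the block from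
  \<open>2 ^ k\<close> to \<open>2 ^ Suc k\<close> monotonicity bounds \<psi> below by its value at
  the right end, so the block dominates a multiple of the term of index
  \<open>Suc k\<close>.\<close>

lemma summable_dyadic:
  fixes \<psi> :: "nat \<Rightarrow> real" and p e :: real
  assumes nonneg: "\<And>q. q \<ge> 1 \<Longrightarrow> \<psi> q \<ge> 0" and mono: "antimono_on {1..} \<psi>" and p: "p \<ge> 0"
    and sum: "summable (\<lambda>q. \<psi> (Suc q) powr p * real (Suc q) powr e)"
  shows "summable (\<lambda>k. \<psi> (2 ^ k) powr p * 2 powr (real k * (e + 1)))"
proof -
  define f where "f = (\<lambda>q. \<psi> q powr p * real q powr e)"
  define h where "h = (\<lambda>k. \<psi> (2 ^ k) powr p * 2 powr (real k * (e + 1)))"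
  \<comment> \<open>The factor 2 compensates for the block having \<open>2 ^ k\<close> elements
    instead of \<open>2 ^ Suc k\<close>; \<open>2 powr \<bar>e\<bar>\<close> covers the variation of
    \<open>q powr e\<close> on a block for either sign of \<open>e\<close>.\<close>
  define c where "c = 2 * 2 powr \<bar>e\<bar>"
  have f0: "f q \<ge> 0" for q by (simp add: f_def)
  have c0: "c > 0" by (simp add: c_def)
  have block: "h (Suc k) \<le> c * (\<Sum>q\<in>{(2::nat)^k<..2^Suc k}. f q)" for k
  proof -
    have "\<psi> (2 ^ Suc k) powr p * (2 powr (real (Suc k) * e) * 2 powr (-\<bar>e\<bar>)) \<le> f q"
      if q: "q \<in> {(2::nat)^k<..2^Suc k}" for q
    proof -
      have q1: "1 \<le> q" using q by simp
      have "\<psi> (2 ^ Suc k) \<le> \<psi> q"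
        using mono q q1 by (auto simp: monotone_on_def)
      then have 1: "\<psi> (2 ^ Suc k) powr p \<le> \<psi> q powr p"
        using nonneg p by (intro powr_mono2) auto
      have rq: "2 ^ k \<le> real q" "real q \<le> 2 ^ Suc k"
      proof -
        have "real (2 ^ k) \<le> real q" "real q \<le> real (2 ^ Suc k)"
          using q by (simp_all only: of_nat_le_iff greaterThanAtMost_iff less_imp_le)
        then show "2 ^ k \<le> real q" "real q \<le> 2 ^ Suc k" by simp_all
      qed
      have "2 powr (real (Suc k) * e) * 2 powr (-\<bar>e\<bar>) \<le> real q powr e"
      proof (cases "e \<ge> 0")
        case True
        have "2 powr (real (Suc k) * e) * 2 powr (-\<bar>e\<bar>) = (2 ^ k) powr e"
          using True by (simp add: powr_add[symmetric] powr_realpow[symmetric] powr_powr algebra_simps)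
        also have "\<dots> \<le> real q powr e" using rq True by (intro powr_mono2) auto
        finally show ?thesis .
      next
        case False
        have "2 powr (real (Suc k) * e) * 2 powr (-\<bar>e\<bar>) \<le> 2 powr (real (Suc k) * e)"
          using False by (simp add: powr_add[symmetric])
        also have "\<dots> = (2 ^ Suc k) powr e"
          by (simp add: powr_realpow[symmetric] powr_powr del: power_Suc)
        also have "\<dots> \<le> real q powr e"
          using rq q1 False by (intro powr_mono2') auto
        finally show ?thesis .
      qed
      then show ?thesis unfolding f_def using 1 by (intro mult_mono) auto
    qed
    then have "(\<Sum>q\<in>{(2::nat)^k<..2^Suc k}. \<psi> (2 ^ Suc k) powr p * (2 powr (real (Suc k) * e) * 2 powr (-\<bar>e\<bar>)))
        \<le> (\<Sum>q\<in>{(2::nat)^k<..2^Suc k}. f q)"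
      by (rule sum_mono)
    moreover have "(\<Sum>q\<in>{(2::nat)^k<..2^Suc k}. \<psi> (2 ^ Suc k) powr p * (2 powr (real (Suc k) * e) * 2 powr (-\<bar>e\<bar>)))
        = 2 ^ k * (\<psi> (2 ^ Suc k) powr p * (2 powr (real (Suc k) * e) * 2 powr (-\<bar>e\<bar>)))"
      by simp
    ultimately have "c * (2 ^ k * (\<psi> (2 ^ Suc k) powr p * (2 powr (real (Suc k) * e) * 2 powr (-\<bar>e\<bar>))))
        \<le> c * (\<Sum>q\<in>{(2::nat)^k<..2^Suc k}. f q)"
      using c0 by (intro mult_left_mono) auto
    moreover have "c * (2 ^ k * (\<psi> (2 ^ Suc k) powr p * (2 powr (real (Suc k) * e) * 2 powr (-\<bar>e\<bar>)))) = h (Suc k)"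
    proof -
      have "2 powr (real (Suc k) * (e + 1)) = 2 powr (real (Suc k) * e) * 2 ^ Suc k"
        by (simp only: distrib_left powr_add mult_1_right powr_realpow zero_less_numeral)
      moreover have "2 powr \<bar>e\<bar> * 2 powr (-\<bar>e\<bar>) = (1::real)" by (simp add: powr_add[symmetric])
      ultimately show ?thesis by (simp add: c_def h_def)
    qed
    ultimately show ?thesis by simp
  qed
  have part: "(\<Sum>k<n. h (Suc k)) \<le> c * (\<Sum>q\<in>{1<..2^n}. f q)" for n
  proof (induction n)
    case (Suc n)
    have "{1<..(2::nat)^Suc n} = {1<..2^n} \<union> {2^n<..2^Suc n}" by auto
    then have "(\<Sum>q\<in>{1<..2^Suc n}. f q) = (\<Sum>q\<in>{1<..2^n}. f q) + (\<Sum>q\<in>{2^n<..2^Suc n}. f q)"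
      by (simp only:) (rule sum.union_disjoint, auto)
    then show ?case using Suc.IH block[of n] by (simp add: distrib_left)
  qed simp
  have "(\<Sum>k<n. h (Suc k)) \<le> c * (\<Sum>q. f (Suc q))" for n
  proof -
    have "(\<Sum>q\<in>{1<..2^n}. f q) \<le> (\<Sum>q\<in>Suc ` {..<2^n}. f q)"
    proof (rule sum_mono2)
      show "{1<..2^n} \<subseteq> Suc ` {..<2^n}"
      proof
        fix q :: nat assume "q \<in> {1<..2^n}"
        then have "q = Suc (q - 1)" "q - 1 < 2 ^ n" by auto
        then show "q \<in> Suc ` {..<2^n}" by blast
      qed
    qed (auto simp: f0)
    also have "\<dots> = (\<Sum>q<2^n. f (Suc q))" by (simp add: sum.reindex)
    also have "\<dots> \<le> (\<Sum>q. f (Suc q))"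
      using sum by (intro sum_le_suminf) (auto simp: f_def)
    finally have "c * (\<Sum>q\<in>{1<..2^n}. f q) \<le> c * (\<Sum>q. f (Suc q))"
      using c0 by (intro mult_left_mono) auto
    then show ?thesis using part[of n] by linarith
  qed
  then have "summable (\<lambda>k. h (Suc k))"
    by (intro summableI_nonneg_bounded) (auto simp: h_def)
  then have "summable h" by (simp only: summable_Suc_iff)
  then show ?thesis unfolding h_def .
qed

section \<open>Points of the affine subspace\<close>

definition graph_point :: "real ^ ('m::finite) ^ ('d::finite option) \<Rightarrow> real ^ 'd \<Rightarrow> real ^ ('d + 'm)" where
  "graph_point M x = vec_append x (prepend_one x v* M)"

text \<open>A crude Lipschitz constant of the graph map in the sup norm. The extra 1 serves the
  identity coordinates and later absorbs the approximation error \<delta> itself, added to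
  \<open>(coeff_bound M - 1) * \<delta>\<close>.\<close>

definition coeff_bound :: "real ^ ('m::finite) ^ ('u::finite) \<Rightarrow> real" where
  "coeff_bound M = 1 + (\<Sum>u\<in>UNIV. \<Sum>i\<in>UNIV. \<bar>M $ u $ i\<bar>)"

lemma sum_option:
  "(\<Sum>u\<in>(UNIV :: 'd::finite option set). f u) = f None + (\<Sum>i\<in>UNIV. f (Some i))"
  by (simp add: UNIV_option_conv sum.reindex)

lemma graph_point_Inl [simp]: "graph_point M x $ Inl i = x $ i"
  by (simp add: graph_point_def vec_append_def)

lemma graph_point_Inr [simp]:
  "graph_point M x $ Inr j = M $ None $ j + (\<Sum>i\<in>UNIV. x $ i * M $ Some i $ j)"
  by (simp add: graph_point_def vec_append_def vector_matrix_mult_def sum_option prepend_one_def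
      mult.commute)

lemma coeff_bound_ge_1: "coeff_bound M \<ge> 1"
  by (simp add: coeff_bound_def sum_nonneg)

lemma column_sum_le:
  fixes M :: "real ^ ('m::finite) ^ ('d::finite option)"
  shows "(\<Sum>i\<in>UNIV. \<bar>M $ Some i $ j\<bar>) \<le> coeff_bound M - 1"
proof -
  have "(\<Sum>i\<in>UNIV. \<bar>M $ Some i $ j\<bar>) \<le> (\<Sum>u\<in>UNIV. \<bar>M $ u $ j\<bar>)"
    by (simp add: sum_option)
  also have "\<dots> \<le> (\<Sum>u\<in>UNIV. \<Sum>i\<in>UNIV. \<bar>M $ u $ i\<bar>)"
    by (intro sum_mono member_le_sum) auto
  finally show ?thesis by (simp add: coeff_bound_def)
qed

lemma column_combination_le:
  fixes M :: "real ^ ('m::finite) ^ ('d::finite option)"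
  assumes "\<And>i. \<bar>z i\<bar> \<le> \<epsilon>" "\<epsilon> \<ge> 0"
  shows "\<bar>\<Sum>i\<in>UNIV. z i * M $ Some i $ j\<bar> \<le> (coeff_bound M - 1) * \<epsilon>"
proof -
  have "\<bar>\<Sum>i\<in>UNIV. z i * M $ Some i $ j\<bar> \<le> (\<Sum>i\<in>UNIV. \<epsilon> * \<bar>M $ Some i $ j\<bar>)"
    using assms by (intro order_trans[OF sum_abs] sum_mono) (auto simp: abs_mult intro: mult_right_mono)
  also have "\<dots> \<le> \<epsilon> * (coeff_bound M - 1)"
    unfolding sum_distrib_left[symmetric] using assms(2) by (intro mult_left_mono column_sum_le)
  finally show ?thesis by (simp add: mult.commute)
qed

text \<open>The translation row \<open>M $ None\<close> cancels in differences. The factor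
  \<open>CARD('d + 'm)\<close> comes from bounding the Euclidean norm by the sum of the
  coordinates.\<close>

lemma dist_graph_point_le:
  fixes M :: "real ^ ('m::finite) ^ ('d::finite option)"
  assumes "\<And>i. \<bar>x $ i - y $ i\<bar> \<le> \<epsilon>" "\<epsilon> \<ge> 0"
  shows "dist (graph_point M x) (graph_point M y) \<le> real CARD('d + 'm) * coeff_bound M * \<epsilon>"
proof -
  have "\<bar>(graph_point M x - graph_point M y) $ k\<bar> \<le> coeff_bound M * \<epsilon>" for k
  proof (cases k)
    case (Inl i)
    have "\<epsilon> \<le> coeff_bound M * \<epsilon>" using coeff_bound_ge_1[of M] assms(2) by (simp add: mult_le_cancel_right1)
    then show ?thesis using assms(1)[of i] by (simp add: Inl)
  next
    case (Inr j)
    have "(graph_point M x - graph_point M y) $ k = (\<Sum>i\<in>UNIV. (x $ i - y $ i) * M $ Some i $ j)"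
      by (simp add: Inr left_diff_distrib sum_subtractf)
    then have "\<bar>(graph_point M x - graph_point M y) $ k\<bar> \<le> (coeff_bound M - 1) * \<epsilon>"
      using column_combination_le[where z = "\<lambda>i. x $ i - y $ i", OF assms, of M j] by simp
    then show ?thesis using assms(2) by (simp add: algebra_simps)
  qed
  then have "(\<Sum>k\<in>UNIV. \<bar>(graph_point M x - graph_point M y) $ k\<bar>) \<le> (\<Sum>k\<in>(UNIV :: ('d + 'm) set). coeff_bound M * \<epsilon>)"
    by (rule sum_mono)
  then show ?thesis
    unfolding dist_norm using norm_le_l1_cart[of "graph_point M x - graph_point M y"] by simp
qed

lemma diameter_cball_le:
  fixes x :: "'a::euclidean_space"
  assumes "r \<ge> 0"
  shows "diameter (cball x r) \<le> 2 * r"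
  using assms by (simp add: diameter_cball)

lemma abs_diff_divide:
  fixes q :: real
  assumes "q > 0"
  shows "\<bar>q * x - p\<bar> / q = \<bar>x - p / q\<bar>"
proof -
  have "q * x - p = q * (x - p / q)" using assms by (simp add: field_simps)
  then show ?thesis using assms by (simp add: abs_mult)
qed

lemma affine_graph_eq_UN:
  "affine_graph M = (\<Union>K::nat. graph_point M ` {x. \<forall>i. \<bar>x $ i\<bar> \<le> real (Suc K)})"
proof -
  have "\<exists>K. \<forall>i. \<bar>x $ i\<bar> \<le> real (Suc K)" for x :: "real ^ 'd"
  proof -
    obtain K where "infnorm x \<le> real K" using real_arch_simple by blast
    then have "\<bar>x $ i\<bar> \<le> real (Suc K)" for i using component_le_infnorm_cart[of x i] by simp
    then show ?thesis by blast
  qed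
  then show ?thesis unfolding affine_graph_def graph_point_def by blast
qed

text \<open>A bounded piece is covered by balls around the images of a grid of mesh 1/Q: there are
  O(Q^d) of them, of radius O(1/Q), and the total cost O(Q^(d-s)) tends to 0.\<close>

lemma hausdorff_null_affine_graph:
  fixes M :: "real ^ ('m::finite) ^ ('d::finite option)" and s :: real
  assumes s: "s > CARD('d)"
  shows "hausdorff_null s (affine_graph M)"
  unfolding affine_graph_eq_UN
proof (rule hausdorff_null_UN)
  fix K0 :: nat
  define K where "K = Suc K0"
  define d where "d = CARD('d)"
  define c where "c = real CARD('d + 'm) * coeff_bound M"
  have c: "c \<ge> 0" using coeff_bound_ge_1[of M] by (simp add: c_def)
  have s0: "s > 0" using s by (rule order_le_less_trans[rotated]) simp
  define E where "E = graph_point M ` {x. \<forall>i. \<bar>x $ i\<bar> \<le> real K}"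
  have cover: "hausdorff_cover s (ennreal ((3 * real K) ^ d * (2 * c) powr s * real (Suc N) powr (real d - s))) E" for N
  proof -
    define Q where "Q = Suc N"
    define I where "I = Pi\<^sub>E (UNIV :: 'd set) (\<lambda>_. {- int (K * Q)..int (K * Q)})"
    define B where "B = (\<lambda>p. cball (graph_point M (\<chi> i. of_int (p i) / real Q)) (c / real Q))"
    have "hausdorff_cover s (ennreal (real (card I) * (2 * c / real Q) powr s)) (\<Union>p\<in>I. B p)"
    proof (rule hausdorff_cover_finite)
      show "finite I" unfolding I_def by (intro finite_PiE) auto
      show "diameter (B p) \<le> 2 * c / real Q" for p
        using diameter_cball_le[of "c / real Q"] c by (simp add: B_def)
    qed (use c s0 in \<open>auto simp: B_def\<close>)
    moreover have "E \<subseteq> (\<Union>p\<in>I. B p)"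
    proof
      fix y assume "y \<in> E"
      then obtain x where x: "y = graph_point M x" "\<And>i. \<bar>x $ i\<bar> \<le> real K" by (auto simp: E_def)
      define p where "p = (\<lambda>i. \<lfloor>real Q * x $ i\<rfloor>)"
      have Q: "real Q > 0" by (simp add: Q_def)
      have "- int (K * Q) \<le> p i \<and> p i \<le> int (K * Q)" for i
      proof -
        have "\<bar>real Q * x $ i\<bar> \<le> real Q * real K"
          using x(2)[of i] by (simp add: abs_mult mult_left_mono)
        then have "real_of_int (- int (K * Q)) \<le> real Q * x $ i" "real Q * x $ i \<le> real_of_int (int (K * Q))"
          by (simp_all add: abs_le_iff mult.commute)
        then show ?thesis
          unfolding p_def le_floor_iff floor_le_iff by linarith
      qed
      then have "p \<in> I" by (auto simp: I_def)
      moreover have "dist (graph_point M x) (graph_point M (\<chi> i. of_int (p i) / real Q)) \<le> c * (1 / real Q)"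
        unfolding c_def
      proof (rule dist_graph_point_le)
        fix i
        have "\<bar>real Q * x $ i - of_int (p i)\<bar> \<le> 1" unfolding p_def by linarith
        then have "\<bar>real Q * x $ i - of_int (p i)\<bar> / real Q \<le> 1 / real Q"
          by (intro divide_right_mono) auto
        moreover have "\<bar>real Q * x $ i - of_int (p i)\<bar> / real Q = \<bar>x $ i - of_int (p i) / real Q\<bar>"
          using Q by (rule abs_diff_divide)
        ultimately show "\<bar>x $ i - (\<chi> i. of_int (p i) / real Q) $ i\<bar> \<le> 1 / real Q" by simp
      qed simp
      ultimately show "y \<in> (\<Union>p\<in>I. B p)" by (auto simp: B_def x(1) dist_commute)
    qed
    moreover have "real (card I) * (2 * c / real Q) powr s
        \<le> (3 * real K) ^ d * (2 * c) powr s * real Q powr (real d - s)"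
    proof -
      have "1 * 1 \<le> real K * real Q" by (intro mult_mono) (auto simp: K_def Q_def)
      then have "real (card I) \<le> (3 * real K * real Q) ^ d"
        unfolding I_def d_def by (simp add: card_PiE nat_add_distrib power_mono)
      then have "real (card I) * (2 * c / real Q) powr s \<le> (3 * real K * real Q) ^ d * (2 * c / real Q) powr s"
        by (intro mult_right_mono) auto
      also have "\<dots> = (3 * real K) ^ d * (2 * c) powr s * real Q powr (real d - s)"
        using c by (simp add: power_mult_distrib powr_divide powr_diff powr_realpow Q_def del: of_nat_Suc)
      finally show ?thesis .
    qed
    ultimately show ?thesis unfolding Q_def[symmetric] by (blast intro: hausdorff_cover_mono ennreal_leI)
  qed
  have "(\<lambda>N. real (Suc N) powr (real d - s)) \<longlonglongrightarrow> 0"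
    using s by (intro tendsto_neg_powr filterlim_compose[OF filterlim_real_sequentially filterlim_Suc])
      (auto simp: d_def)
  then have "(\<lambda>N. (3 * real K) ^ d * (2 * c) powr s * real (Suc N) powr (real d - s)) \<longlonglongrightarrow> 0"
    by (rule tendsto_mult_right_zero)
  then have "\<exists>N. (3 * real K) ^ d * (2 * c) powr s * real (Suc N) powr (real d - s) < \<epsilon>" if "\<epsilon> > 0" for \<epsilon>
    using order_tendstoD(2)[OF _ that] eventually_happens'[OF sequentially_bot] by blast
  then show "hausdorff_null s (graph_point M ` {x. \<forall>i. \<bar>x $ i\<bar> \<le> real (Suc K0)})"
    unfolding hausdorff_null_def E_def[symmetric] K_def[symmetric]
    using cover by (blast intro: hausdorff_cover_mono ennreal_leI less_imp_le)
qed

section \<open>The convergence case\<close>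

lemma dyadic_floor:
  fixes q :: nat
  assumes "q \<ge> 1"
  obtains k where "2 ^ k \<le> q" "q < 2 ^ Suc k"
  using ex_power_ivl1[of 2 q] assms by auto

lemma dist_int_coord_less:
  assumes "dist_int_vec y < \<delta>"
  shows "dist_int (y $ k) < \<delta>"
proof -
  have "dist_int (y $ k) \<le> dist_int_vec y" unfolding dist_int_vec_def by (intro Max_ge) auto
  then show ?thesis using assms by simp
qed

text \<open>The witness \<open>v\<close> consists of \<open>q\<close> and the rounded coordinates of
  \<open>q x\<close>. The graph map is affine, so \<open>v M\<close> differs from the last
  coordinates of q times the point only by the propagated rounding errors.\<close>

lemma approx_point_in_ball:
  fixes M :: "real ^ ('m::finite) ^ ('d::finite option)"
  assumes near: "dist_int_vec (real q *\<^sub>R graph_point M x) < \<delta>"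
    and q: "2 ^ k \<le> q" "q < 2 ^ Suc k" and x: "\<And>i. \<bar>x $ i\<bar> \<le> real K"
  obtains v where "v \<in> Pi\<^sub>E UNIV (\<lambda>_. {- int ((2 * K + 2) * 2 ^ k)..int ((2 * K + 2) * 2 ^ k)})"
    and "\<forall>j. dist_int (\<Sum>u\<in>UNIV. of_int (v u) * M $ u $ j) \<le> coeff_bound M * \<delta>"
    and "dist (graph_point M x) (graph_point M (\<chi> i. of_int (v (Some i)) / of_int (v None)))
           \<le> real CARD('d + 'm) * coeff_bound M * (\<delta> / 2 ^ k)"
proof -
  define p where "p = (\<lambda>i. round (real q * x $ i))"
  define v where "v = case_option (int q) p"
  have \<delta>: "\<delta> \<ge> 0"
    using dist_int_coord_less[OF near] dist_int_nonneg by (meson less_imp_le order_le_less_trans)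
  have p: "\<bar>real q * x $ i - of_int (p i)\<bar> \<le> \<delta>" for i
    using dist_int_coord_less[OF near, of "Inl i"] by (simp add: dist_int_eq p_def)
  have q2: "2 ^ k \<le> real q" "real q \<le> 2 * 2 ^ k"
  proof -
    have "real (2 ^ k) \<le> real q" "real q \<le> real (2 ^ Suc k)"
      using q by (simp_all only: of_nat_le_iff less_imp_le)
    then show "2 ^ k \<le> real q" "real q \<le> 2 * 2 ^ k" by simp_all
  qed
  have q0: "real q > 0" by (rule less_le_trans[OF _ q2(1)]) simp
  have one: "(1::real) \<le> 2 ^ k" by simp
  \<comment> \<open>Since \<open>q\<close> is below \<open>2 * 2 ^ k\<close>, the coordinates of
    \<open>q x\<close> are at most \<open>2 * K * 2 ^ k\<close> in modulus; the summand 2 makes room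
    for \<open>q\<close> itself and for rounding.\<close>
  have v_le: "\<bar>v u\<bar> \<le> int ((2 * K + 2) * 2 ^ k)" for u
  proof -
    have "\<bar>real_of_int (v u)\<bar> \<le> (2 * real K + 2) * 2 ^ k"
    proof (cases u)
      case None
      have "2 * 2 ^ k \<le> (2 * real K + 2) * 2 ^ k" by (intro mult_right_mono) auto
      then have "real q \<le> (2 * real K + 2) * 2 ^ k" using q2 by linarith
      then show ?thesis by (simp add: v_def None)
    next
      case (Some i)
      have "\<bar>real q * x $ i\<bar> \<le> (2 * 2 ^ k) * real K"
        unfolding abs_mult using x[of i] q2 by (intro mult_mono) auto
      moreover have "\<bar>real_of_int (p i) - real q * x $ i\<bar> \<le> 1/2"
        unfolding p_def by (rule of_int_round_abs_le)
      ultimately have "\<bar>real_of_int (p i)\<bar> \<le> (2 * 2 ^ k) * real K + 2 * 2 ^ k" using one by linarith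
      also have "\<dots> = (2 * real K + 2) * 2 ^ k" by algebra
      finally show ?thesis by (simp add: v_def Some)
    qed
    also have "\<dots> = real_of_int (int ((2 * K + 2) * 2 ^ k))" by (simp add: distrib_right)
    finally show ?thesis by (simp only: of_int_abs[symmetric] of_int_le_iff)
  qed
  have "v u \<in> {- int ((2 * K + 2) * 2 ^ k)..int ((2 * K + 2) * 2 ^ k)}" for u
    using v_le[of u] unfolding atLeastAtMost_iff by linarith
  then have "v \<in> Pi\<^sub>E UNIV (\<lambda>_. {- int ((2 * K + 2) * 2 ^ k)..int ((2 * K + 2) * 2 ^ k)})"
    by (intro PiE_I) auto
  moreover have "dist_int (\<Sum>u\<in>UNIV. of_int (v u) * M $ u $ j) \<le> coeff_bound M * \<delta>" for j
  proof -
    \<comment> \<open>The row \<open>M $ None\<close> enters both sides with the exact coefficient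
      \<open>q\<close>, so only the rounding errors in \<open>p\<close> remain.\<close>
    have "(\<Sum>u\<in>UNIV. of_int (v u) * M $ u $ j) - (real q *\<^sub>R graph_point M x) $ Inr j
        = - (\<Sum>i\<in>UNIV. (real q * x $ i - of_int (p i)) * M $ Some i $ j)"
      by (simp add: sum_option v_def distrib_left sum_distrib_left left_diff_distrib sum_subtractf mult.assoc)
    then have "\<bar>(\<Sum>u\<in>UNIV. of_int (v u) * M $ u $ j) - (real q *\<^sub>R graph_point M x) $ Inr j\<bar>
        \<le> (coeff_bound M - 1) * \<delta>"
      using column_combination_le[of "\<lambda>i. real q * x $ i - of_int (p i)" \<delta> M j] p \<delta> by simp
    then have "dist_int (\<Sum>u\<in>UNIV. of_int (v u) * M $ u $ j) \<le> \<delta> + (coeff_bound M - 1) * \<delta>"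
      using dist_int_perturb[of "\<Sum>u\<in>UNIV. of_int (v u) * M $ u $ j" "(real q *\<^sub>R graph_point M x) $ Inr j"]
        dist_int_coord_less[OF near, of "Inr j"] by linarith
    then show ?thesis by (simp add: algebra_simps)
  qed
  moreover have "dist (graph_point M x) (graph_point M (\<chi> i. of_int (v (Some i)) / of_int (v None)))
      \<le> real CARD('d + 'm) * coeff_bound M * (\<delta> / 2 ^ k)"
  proof (rule dist_graph_point_le)
    fix i
    have "\<bar>real q * x $ i - of_int (p i)\<bar> / real q \<le> \<delta> / 2 ^ k"
      using p[of i] q2 by (intro frac_le) (auto simp: \<delta>)
    moreover have "\<bar>real q * x $ i - of_int (p i)\<bar> / real q = \<bar>x $ i - of_int (p i) / real q\<bar>"
      using q0 by (rule abs_diff_divide)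
    ultimately show "\<bar>x $ i - (\<chi> i. of_int (v (Some i)) / of_int (v None)) $ i\<bar> \<le> \<delta> / 2 ^ k"
      by (simp add: v_def)
  qed (use \<delta> in simp)
  ultimately show ?thesis using that by blast
qed

text \<open>The upper bound on \<open>w * \<tau>\<close> makes the count valid down to radius
  parameter \<open>2 powr (- \<tau> * k)\<close>; the lower bound on \<tau> makes the cost of
  enlarging \<psi> to that threshold a convergent geometric series.\<close>

lemma hausdorff_null_simult_approx:
  fixes M :: "real ^ ('m::finite) ^ ('d::finite option)" and \<psi> :: "nat \<Rightarrow> real" and s w \<tau> :: real
  assumes s: "s > 0"
    and nonneg: "\<And>q. q \<ge> 1 \<Longrightarrow> \<psi> q \<ge> 0" and mono: "antimono_on {1..} \<psi>"
    and sum: "summable (\<lambda>q. \<psi> (Suc q) powr (real CARD('m) + s) * real (Suc q) powr (real CARD('d) - s))"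
    and w: "mult_exponent M < ereal w" "w > 0"
    and \<tau>: "\<tau> > 0" "w * \<tau> < CARD('d) + 1" "CARD('d) + 1 - s < \<tau> * (CARD('m) + s)"
  shows "hausdorff_null s (simult_approx \<psi> \<inter> affine_graph M)"
proof -
  define m where "m = CARD('m)"
  define D where "D = CARD('d) + 1"
  have D: "CARD('d option) = D" by (simp add: D_def)
  define c where "c = real CARD('d + 'm) * coeff_bound M"
  have cb: "coeff_bound M \<ge> 1" by (rule coeff_bound_ge_1)
  have c: "c \<ge> 0" using cb by (simp add: c_def)
  define \<Psi> where "\<Psi> = (\<lambda>k::nat. max (\<psi> (2 ^ k)) (2 powr (- \<tau> * real k)))"
  have \<Psi>0: "\<Psi> k > 0" for k by (simp add: \<Psi>_def less_max_iff_disj)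
  \<comment> \<open>The cost of level \<open>k\<close> up to a constant: about
    \<open>\<Psi> k ^ m * 2 ^ (k * D)\<close> balls of radius about \<open>\<Psi> k / 2 ^ k\<close>,
    each raised to the power \<open>s\<close>.\<close>
  define t where "t = (\<lambda>k. \<Psi> k powr (real m + s) * 2 powr (real k * (real D - s)))"
  have summable_t: "summable t"
  proof (rule summable_comparison_test')
    have "summable (\<lambda>k. \<psi> (2 ^ k) powr (real CARD('m) + s) * 2 powr (real k * ((real CARD('d) - s) + 1)))"
      using s by (intro summable_dyadic nonneg mono sum) auto
    moreover have "summable (\<lambda>k. (2 powr (real D - s - \<tau> * (real m + s))) ^ k)"
      using \<tau>(3) by (intro summable_geometric) (simp add: D_def m_def powr_less_one)
    ultimately show "summable (\<lambda>k. \<psi> (2 ^ k) powr (real m + s) * 2 powr (real k * (real D - s))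
        + (2 powr (real D - s - \<tau> * (real m + s))) ^ k)"
      by (intro summable_add) (auto simp: D_def m_def algebra_simps)
    fix k :: nat
    have "\<Psi> k powr (real m + s) \<le> \<psi> (2 ^ k) powr (real m + s) + (2 powr (- \<tau> * real k)) powr (real m + s)"
      by (simp add: \<Psi>_def max_def)
    then have "t k \<le> (\<psi> (2 ^ k) powr (real m + s) + (2 powr (- \<tau> * real k)) powr (real m + s))
        * 2 powr (real k * (real D - s))"
      unfolding t_def by (intro mult_right_mono) auto
    also have "\<dots> = \<psi> (2 ^ k) powr (real m + s) * 2 powr (real k * (real D - s))
        + (2 powr (real D - s - \<tau> * (real m + s))) ^ k"
      by (simp add: distrib_right powr_powr powr_power powr_add[symmetric] algebra_simps)
    finally show "norm (t k) \<le> \<psi> (2 ^ k) powr (real m + s) * 2 powr (real k * (real D - s))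
        + (2 powr (real D - s - \<tau> * (real m + s))) ^ k"
      by (simp add: t_def)
  qed
  have "hausdorff_null s (simult_approx \<psi> \<inter> graph_point M ` {x. \<forall>i. \<bar>x $ i\<bar> \<le> real (Suc K0)})" for K0
  proof -
    \<comment> \<open>The size of the box in \<open>approx_point_in_ball\<close> for points with
      coordinates at most \<open>Suc K0\<close>.\<close>
    define K where "K = 2 * Suc K0 + 2"
    define V where "V = (\<lambda>k. {v \<in> Pi\<^sub>E (UNIV :: 'd option set) (\<lambda>_. {- int (K * 2^k)..int (K * 2^k)}).
        \<forall>i. dist_int (\<Sum>u\<in>UNIV. of_int (v u) * M $ u $ i) \<le> coeff_bound M * \<Psi> k})"
    define ctr where "ctr = (\<lambda>v :: 'd option \<Rightarrow> int. graph_point M (\<chi> i. of_int (v (Some i)) / of_int (v None)))"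
    define G where "G = (\<lambda>k. \<Union>v\<in>V k. cball (ctr v) (c * (\<Psi> k / 2 ^ k)))"
    have "K \<ge> 1" by (simp add: K_def)
    moreover have "w * \<tau> < real CARD('d option)" using \<tau>(2) by (simp add: add.commute)
    ultimately obtain C where "C > 0" and C: "\<forall>k \<delta>. 2 powr (- \<tau> * real k) \<le> \<delta> \<longrightarrow>
       real (card {v \<in> Pi\<^sub>E UNIV (\<lambda>_. {-int (K * 2^k)..int (K * 2^k)}).
          \<forall>i. dist_int (\<Sum>u\<in>UNIV. of_int (v u) * M $ u $ i) \<le> \<delta>})
         \<le> C * \<delta> ^ CARD('m) * 2 ^ (k * CARD('d option))"
      using card_near_lattice_dyadic[OF w \<tau>(1)] by blast
    define C' where "C' = C * coeff_bound M ^ m * (2 * c) powr s"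
    have "C' \<ge> 0" using \<open>C > 0\<close> cb by (simp add: C'_def)
    have card_V: "real (card (V k)) \<le> C * (coeff_bound M * \<Psi> k) ^ m * 2 ^ (k * D)" for k
    proof -
      have "2 powr (- \<tau> * real k) \<le> 1 * \<Psi> k" by (simp add: \<Psi>_def)
      also have "\<dots> \<le> coeff_bound M * \<Psi> k" using cb \<Psi>0[of k] by (intro mult_right_mono) auto
      finally show ?thesis using C unfolding V_def m_def D by blast
    qed
    show ?thesis
    proof (rule hausdorff_null_limsup[where G = G and a = "\<lambda>k. C' * t k"])
      fix k
      have "hausdorff_cover s (ennreal (real (card (V k)) * (2 * c * (\<Psi> k / 2 ^ k)) powr s)) (G k)"
        unfolding G_def
      proof (rule hausdorff_cover_finite)
        have "finite (Pi\<^sub>E (UNIV :: 'd option set) (\<lambda>_. {- int (K * 2^k)..int (K * 2^k)}))"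
          by (intro finite_PiE) auto
        then show "finite (V k)" unfolding V_def by simp
        show "diameter (cball (ctr v) (c * (\<Psi> k / 2 ^ k))) \<le> 2 * c * (\<Psi> k / 2 ^ k)" for v
          using diameter_cball_le[of "c * (\<Psi> k / 2 ^ k)" "ctr v"] c \<Psi>0[of k] by simp
      qed (use c s \<Psi>0[of k] in auto)
      moreover have "real (card (V k)) * (2 * c * (\<Psi> k / 2 ^ k)) powr s \<le> C' * t k"
      proof -
        have "real (card (V k)) * (2 * c * (\<Psi> k / 2 ^ k)) powr s
            \<le> C * (coeff_bound M * \<Psi> k) ^ m * 2 ^ (k * D) * (2 * c * (\<Psi> k / 2 ^ k)) powr s"
          by (intro mult_right_mono card_V) auto
        moreover have "(2 * c * (\<Psi> k / 2 ^ k)) powr s = (2 * c) powr s * (\<Psi> k powr s / 2 powr (real k * s))"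
          using c \<Psi>0[of k] by (simp add: powr_mult powr_divide powr_realpow[symmetric] powr_powr)
        moreover have "(coeff_bound M * \<Psi> k) ^ m = coeff_bound M ^ m * \<Psi> k powr real m"
          using \<Psi>0[of k] by (simp add: power_mult_distrib powr_realpow)
        moreover have "(2::real) ^ (k * D) = 2 powr (real k * real D)"
          by (simp add: powr_realpow[symmetric])
        moreover have "C * (coeff_bound M ^ m * \<Psi> k powr real m) * 2 powr (real k * real D)
              * ((2 * c) powr s * (\<Psi> k powr s / 2 powr (real k * s)))
            = C' * ((\<Psi> k powr real m * \<Psi> k powr s) * (2 powr (real k * real D) / 2 powr (real k * s)))"
          by (simp add: C'_def)
        moreover have "C' * ((\<Psi> k powr real m * \<Psi> k powr s) * (2 powr (real k * real D) / 2 powr (real k * s))) = C' * t k"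
          by (simp add: t_def powr_add powr_diff right_diff_distrib)
        ultimately show ?thesis by (simp only:)
      qed
      ultimately show "hausdorff_cover s (ennreal (C' * t k)) (G k)"
        by (blast intro: hausdorff_cover_mono ennreal_leI)
    next
      show "C' * t k \<ge> 0" for k using \<open>C' \<ge> 0\<close> by (simp add: t_def)
      show "summable (\<lambda>k. C' * t k)" using summable_t by (rule summable_mult)
    next
      fix N
      show "simult_approx \<psi> \<inter> graph_point M ` {x. \<forall>i. \<bar>x $ i\<bar> \<le> real (Suc K0)} \<subseteq> (\<Union>k. G (k + N))"
      proof
        fix y assume "y \<in> simult_approx \<psi> \<inter> graph_point M ` {x. \<forall>i. \<bar>x $ i\<bar> \<le> real (Suc K0)}"
        then obtain x where y: "y = graph_point M x" and x: "\<And>i. \<bar>x $ i\<bar> \<le> real (Suc K0)"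
          and inf: "infinite {q::nat. 1 \<le> q \<and> dist_int_vec (real q *\<^sub>R graph_point M x) < \<psi> q}"
          by (auto simp: simult_approx_def)
        \<comment> \<open>A denominator beyond \<open>2 ^ N\<close> has dyadic level
          \<open>k\<close> at least \<open>N\<close>, so the point is caught by the tail of the
          family \<open>G\<close>.\<close>
        obtain q where q: "q > 2 ^ N" "1 \<le> q" "dist_int_vec (real q *\<^sub>R graph_point M x) < \<psi> q"
          using inf unfolding infinite_nat_iff_unbounded by blast
        obtain k where k: "2 ^ k \<le> q" "q < 2 ^ Suc k" using dyadic_floor[OF q(2)] by blast
        have "(2::nat) ^ N < 2 ^ Suc k" using q(1) k(2) by linarith
        then have "N < Suc k" by (rule power_less_imp_less_exp[rotated]) simp
        have "\<psi> q \<le> \<psi> (2 ^ k)" using mono k(1) q(2) by (auto simp: monotone_on_def)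
        then have "dist_int_vec (real q *\<^sub>R graph_point M x) < \<Psi> k"
          using q(3) by (simp add: \<Psi>_def less_max_iff_disj)
        then obtain v where v: "v \<in> Pi\<^sub>E UNIV (\<lambda>_. {- int (K * 2 ^ k)..int (K * 2 ^ k)})"
          "\<forall>j. dist_int (\<Sum>u\<in>UNIV. of_int (v u) * M $ u $ j) \<le> coeff_bound M * \<Psi> k"
          "dist (graph_point M x) (ctr v) \<le> c * (\<Psi> k / 2 ^ k)"
          unfolding K_def c_def ctr_def using approx_point_in_ball[OF _ k x] by blast
        then have "y \<in> G k" by (auto simp: G_def V_def y dist_commute)
        then have "y \<in> G ((k - N) + N)" using \<open>N < Suc k\<close> by simp
        then show "y \<in> (\<Union>k. G (k + N))" by blast
      qed
    qed
  qed
  then have "hausdorff_null s (\<Union>K0. simult_approx \<psi> \<inter> graph_point M ` {x. \<forall>i. \<bar>x $ i\<bar> \<le> real (Suc K0)})"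
    by (rule hausdorff_null_UN)
  then show ?thesis unfolding affine_graph_eq_UN Int_UN_distrib .
qed

theorem theorem1p3:
  fixes A :: "real ^ ('m::finite) ^ ('d::finite)" and \<alpha>\<^sub>0 :: "real ^ 'm"
    and s :: real and \<psi> :: "nat \<Rightarrow> real" and n d :: nat
  assumes "n = CARD('d + 'm)" and "d = CARD('d)"
    and "s > 0"
    and "\<forall>q\<ge>1. \<psi> q \<ge> 0" and "antimono_on {1..} \<psi>"
    and "summable (\<lambda>q. \<psi> (Suc q) powr (real n - real d + s) * real (Suc q) powr (real d - s))"
    and "mult_exponent (prepend_row \<alpha>\<^sub>0 A)
           < ereal ((real d + 1) * (real n - real d + s)) / ereal (real d + 1 - s)"
  shows "hausdorff_measure s
           (simult_approx \<psi> \<inter> affine_graph (prepend_row \<alpha>\<^sub>0 A)) = 0"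
proof (rule hausdorff_measure_null[OF \<open>s > 0\<close>])
  let ?M = "prepend_row \<alpha>\<^sub>0 A"
  show "hausdorff_null s (simult_approx \<psi> \<inter> affine_graph ?M)"
  \<comment> \<open>Splitting at \<open>d\<close> rather than at \<open>d + 1\<close> keeps the
    denominator \<open>d + 1 - s\<close> at least 1 in the remaining case.\<close>
  proof (cases "s > real d")
    case True
    then have "hausdorff_null s (affine_graph ?M)"
      by (intro hausdorff_null_affine_graph) (simp add: assms(2))
    then show ?thesis by (rule hausdorff_null_subset) blast
  next
    case False
    define D where "D = real d + 1"
    define m where "m = real CARD('m)"
    have m: "real n - real d = m" by (simp add: assms(1,2) m_def)
    have D: "D > 0" "D - s > 0" and ms: "m + s > 0" using False \<open>s > 0\<close> by (auto simp: D_def m_def)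
    define W where "W = D * (m + s) / (D - s)"
    have W: "W > 0" using D ms by (simp add: W_def)
    have "mult_exponent ?M < ereal W"
      using assms(7) D unfolding m D_def[symmetric] by (simp add: W_def)
    \<comment> \<open>The maximum with 0 forces the intermediate value \<open>w\<close> to be
      positive.\<close>
    then have "max 0 (mult_exponent ?M) < ereal W" using W by simp
    then obtain w where "max 0 (mult_exponent ?M) < ereal w" "ereal w < ereal W"
      using ereal_dense2 by blast
    then have w: "mult_exponent ?M < ereal w" "w > 0" "w < W" by auto
    \<comment> \<open>The inequality \<open>w < W\<close> says exactly that the two conditions on
      \<tau> leave a nonempty open interval.\<close>
    have "(D - s) / (m + s) < D / w"
      using w(2,3) D ms by (simp add: W_def field_simps)
    then obtain \<tau> where \<tau>: "(D - s) / (m + s) < \<tau>" "\<tau> < D / w" using dense by blast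
    have "\<tau> > 0" using \<tau>(1) D ms by (meson divide_pos_pos less_trans)
    moreover have "w * \<tau> < D" using \<tau>(2) w(2) by (simp add: field_simps)
    moreover have "D - s < \<tau> * (m + s)" using \<tau>(1) ms by (simp add: field_simps)
    ultimately show ?thesis
      using assms(4-6) w(1,2) \<open>s > 0\<close> unfolding m
      by (intro hausdorff_null_simult_approx[where w = w and \<tau> = \<tau>]) (auto simp: D_def m_def assms(2))
  qed
qed

end
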